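(* Let $\tilde L=(\ell_{ij})\in\mathbb{R}^{n\times n}$ be a standardized Laplacian matrix, $J$ the $n\times n$ matrix with all entries $1/n$, $K=I-J$, $P=\tilde L+J$ and $\tilde L_c=K-\tilde L$. Let $d$ be the in-forest dimension of the digraph $G$ of $\tilde L$ and $d_c$ the in-forest dimension of the complementary digraph $G_c$. For a square matrix $A$ let $m_A(\lambda)$ be the algebraic multiplicity of $\lambda$ as an eigenvalue of $A$ (zero if $\lambda$ is not an eigenvalue) and $V_A(\lambda)$ the set of eigenvectors of $A$ corresponding to $\lambda$. Then: (i) $m_{\tilde L}(0)=d$ and $m_{\tilde L}(1)=d_c-1$; (ii) $m_P(0)=d-1$ and $m_P(1)=d_c$; (iii) $m_{\tilde L_c}(1)=d-1$ and $m_{\tilde L_c}(0)=d_c$; and each of these eigenvalues (whenever it is an eigenvalue) is semisimple, i.e., its algebraic and geometric multiplicities coincide. (iv) If $v\in V_{\tilde L}(0)$ and $Kv\ne 0$, then $Kv\in V_P(0)=V_{\tilde L_c}(1)$; if $x\in V_P(1)=V_{\tilde L_c}(0)$ and $Kx\ne0$, then $Kx\in V_{\tilde L}(1)$.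
   Context: A standardized Laplacian matrix of order $n$ is a real matrix $\tilde L=(\ell_{ij})\in\mathbb{R}^{n\times n}$ such that $-\frac1n\le \ell_{ij}\le 0$ for all $j\ne i$ and $\sum_{j=1}^n \ell_{ij}=0$ for every $i$. The digraph $G$ of $\tilde L$ has vertex set $\{1,\dots,n\}$ and an arc $(i,j)$, $j\ne i$, iff $\ell_{ij}<0$ (with weight proportional to $-\ell_{ij}$). The complementary digraph $G_c$ has vertex set $\{1,\dots,n\}$ and an arc $(i,j)$, $j\ne i$, iff $\ell_{ij}>-\frac1n$ (with weight proportional to $\frac1n+\ell_{ij}$); its standardized Laplacian matrix is $\tilde L_c$. A converging tree (in-tree) is a directed tree with a root such that every non-root vertex has exactly one outgoing arc and all paths lead to the root; a spanning converging forest (in-forest) of a digraph is a spanning subgraph each of whose weakly connected components is a converging tree. The in-forest dimension of a digraph is the minimum possible number of trees in a spanning converging forest of it. *)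

theory Defs
  imports
    "Jordan_Normal_Form.Char_Poly"
    "Jordan_Normal_Form.Matrix_Kernel"
    "Graph_Theory.Digraph_Component"
begin

definition standardized_laplacian :: "nat \<Rightarrow> real mat \<Rightarrow> bool" where
  "standardized_laplacian n L \<longleftrightarrow>
     L \<in> carrier_mat n n \<and>
     (\<forall>i<n. \<forall>j<n. j \<noteq> i \<longrightarrow> - (1 / real n) \<le> L $$ (i, j) \<and> L $$ (i, j) \<le> 0) \<and>
     (\<forall>i<n. (\<Sum>j<n. L $$ (i, j)) = 0)"

text \<open>Vertices are the row indices \<open>0, \<dots>, n - 1\<close>. Arc weights play no role in the in-forest
  dimension and are not recorded.\<close>

definition laplacian_digraph :: "real mat \<Rightarrow> (nat, nat \<times> nat) pre_digraph" where
  "laplacian_digraph L = with_proj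
     \<lparr> pverts = {..<dim_row L},
       parcs = {(i, j). i < dim_row L \<and> j < dim_row L \<and> j \<noteq> i \<and> L $$ (i, j) < 0} \<rparr>"

definition complementary_digraph :: "real mat \<Rightarrow> (nat, nat \<times> nat) pre_digraph" where
  "complementary_digraph L = with_proj
     \<lparr> pverts = {..<dim_row L},
       parcs = {(i, j). i < dim_row L \<and> j < dim_row L \<and> j \<noteq> i \<and>
                        L $$ (i, j) > - (1 / real (dim_row L))} \<rparr>"

text \<open>The library predicate \<^const>\<open>tree\<close> asks for weak connectedness and the absence of directed
  cycles only. Together with the out-degree condition this does force the underlying undirected
  graph to be a tree: the root then has no outgoing arc, so a finite converging tree has exactly
  one arc less than it has vertices (lemmas below).\<close>

definition converging_tree :: "('a, 'b) pre_digraph \<Rightarrow> bool" where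
  "converging_tree T \<longleftrightarrow> wf_digraph T \<and> tree T \<and>
     (\<exists>r \<in> verts T. (\<forall>v \<in> verts T - {r}. out_degree T v = 1) \<and>
                    (\<forall>v \<in> verts T. v \<rightarrow>\<^sup>*\<^bsub>T\<^esub> r))"

definition weak_components :: "('a, 'b) pre_digraph \<Rightarrow> ('a, 'b) pre_digraph set" where
  "weak_components G = {H. pre_digraph.max_subgraph G Digraph_Component.connected H}"

definition spanning_converging_forest ::
  "('a, 'b) pre_digraph \<Rightarrow> ('a, 'b) pre_digraph \<Rightarrow> bool" where
  "spanning_converging_forest F G \<longleftrightarrow>
     spanning F G \<and> (\<forall>T \<in> weak_components F. converging_tree T)"

definition in_forest_dimension :: "('a, 'b) pre_digraph \<Rightarrow> nat" where
  "in_forest_dimension G =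
     (LEAST k. \<exists>F. spanning_converging_forest F G \<and> card (weak_components F) = k)"

definition alg_mult :: "'a :: field mat \<Rightarrow> 'a \<Rightarrow> nat" where
  "alg_mult A k = Polynomial.order k (char_poly A)"

text \<open>\<^term>\<open>char_matrix A k\<close> is \<open>A - k I\<close>, so its kernel is the eigenspace of \<open>k\<close>.\<close>

definition geom_mult :: "'a :: field mat \<Rightarrow> 'a \<Rightarrow> nat" where
  "geom_mult A k = kernel_dim (char_matrix A k)"

definition semisimple :: "'a :: field mat \<Rightarrow> 'a \<Rightarrow> bool" where
  "semisimple A k \<longleftrightarrow> alg_mult A k = geom_mult A k"

definition eigenvectors :: "'a :: field mat \<Rightarrow> 'a \<Rightarrow> 'a vec set" where
  "eigenvectors A k = {v. eigenvector A v k}"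

lemma converging_tree_root_out_arcs:
  assumes "wf_digraph T" "tree T" "r \<in> verts T" "\<forall>v \<in> verts T. v \<rightarrow>\<^sup>*\<^bsub>T\<^esub> r"
  shows "out_arcs T r = {}"
proof (rule ccontr)
  interpret wf_digraph T by fact
  assume "out_arcs T r \<noteq> {}"
  then obtain e where e: "e \<in> arcs T" "tail T e = r" by (auto simp: out_arcs_def)
  then have "head T e \<rightarrow>\<^sup>*\<^bsub>T\<^esub> r" using assms(4) by auto
  then obtain p where p: "apath (head T e) p r" by (metis reachable_apath)
  then have "cycle (e # p)"
    using e unfolding cycle_def apath_def
    by (intro exI[of _ r]) (auto simp: awalk_simps)
  then show False using assms(2) unfolding tree_def forest_def by blast
qed

lemma converging_tree_card_arcs:
  assumes "converging_tree T" "finite (verts T)"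
  shows "card (arcs T) + 1 = card (verts T)"
proof -
  from assms(1) obtain r where T: "wf_digraph T" "tree T" and r: "r \<in> verts T"
    and out: "\<forall>v \<in> verts T - {r}. out_degree T v = 1" and reach: "\<forall>v \<in> verts T. v \<rightarrow>\<^sup>*\<^bsub>T\<^esub> r"
    unfolding converging_tree_def by blast
  interpret wf_digraph T by fact
  have r0: "out_arcs T r = {}"
    by (rule converging_tree_root_out_arcs[OF T r reach])
  have arcs: "arcs T = (\<Union>v \<in> verts T - {r}. out_arcs T v)"
    using r0 by (auto simp: out_arcs_def)
  have one: "card (out_arcs T v) = 1" if "v \<in> verts T - {r}" for v
    using out that by (simp add: out_degree_def)
  have "card (arcs T) = (\<Sum>v \<in> verts T - {r}. card (out_arcs T v))"
    unfolding arcs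
  proof (rule card_UN_disjoint)
    show "\<forall>v \<in> verts T - {r}. finite (out_arcs T v)"
      using one by (metis card.infinite zero_neq_one)
  qed (use assms(2) in \<open>auto simp: out_arcs_def\<close>)
  also have "\<dots> = card (verts T - {r})" using one by simp
  finally show ?thesis using card_Suc_Diff1[OF assms(2) r] by simp
qed

end

theory Submission
  imports Defs
begin

text \<open>
  Let \<open>R\<close> be a smallest set of vertices such that every vertex reaches \<open>R\<close>. The in-forest dimension
  is the size of \<open>R\<close>: the roots of a forest form such a set, and a shortest-path forest into \<open>R\<close>
  has \<open>R\<close> as its roots. By the maximum principle a vector in the kernel of \<open>L\<close> is determined by its
  values on \<open>R\<close>, and minimality of \<open>R\<close> makes every choice of values possible, so the kernel has
  dimension \<open>card R\<close>. If \<open>L (L v) = 0\<close> then \<open>(I + t L) (v - t L v) = v\<close>, and since \<open>I + t L\<close> does not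
  decrease the maximum norm for \<open>t \<ge> 0\<close>, the vectors \<open>v - t L v\<close> stay bounded and \<open>L v = 0\<close>; hence the
  eigenvalue \<open>0\<close> is semisimple.

  The rest follows from \<open>L J = 0\<close>: adding \<open>J\<close> to \<open>L\<close> moves exactly one eigenvalue \<open>0\<close> to \<open>1\<close>, and
  \<open>Lc = I - P\<close>, \<open>Lc + J = I - L\<close>, where \<open>Lc\<close> is the standardized Laplacian of the complementary digraph.
\<close>

section \<open>Eigenspaces and characteristic polynomials\<close>

text \<open>The block matrix \<open>?N\<close> is multiplied from the right by two triangular
  matrices. \<open>?E\<close> has determinant 1 and clears \<open>C\<close>, leaving the Schur
  complement \<open>M - t B C\<close>; \<open>?F\<close> has determinant \<open>a ^ g\<close> and
  clears the upper right block because \<open>M B = a B\<close>. The comparison involves no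
  division, so \<open>a = 0\<close> is covered.\<close>

lemma det_eigenspace_update:
  fixes M :: "'a :: idom mat"
  assumes M: "M \<in> carrier_mat n n" and B: "B \<in> carrier_mat n g" and C: "C \<in> carrier_mat g n"
    and MB: "M * B = a \<cdot>\<^sub>m B" and CB: "C * B = 1\<^sub>m g"
  shows "det (M - t \<cdot>\<^sub>m (B * C)) * a ^ g = det M * (a - t) ^ g"
proof -
  let ?N = "four_block_mat M (t \<cdot>\<^sub>m B) C (1\<^sub>m g)"
  let ?E = "four_block_mat (1\<^sub>m n) (0\<^sub>m n g) (- C) (1\<^sub>m g)"
  let ?F = "four_block_mat (1\<^sub>m n) ((- t) \<cdot>\<^sub>m B) (0\<^sub>m g n) (a \<cdot>\<^sub>m 1\<^sub>m g)"
  have tB: "t \<cdot>\<^sub>m B \<in> carrier_mat n g" "(- t) \<cdot>\<^sub>m B \<in> carrier_mat n g" 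
    and mC: "- C \<in> carrier_mat g n" and BC: "B * C \<in> carrier_mat n n"
    and a1: "a \<cdot>\<^sub>m 1\<^sub>m g \<in> carrier_mat g g" "(a - t) \<cdot>\<^sub>m 1\<^sub>m g \<in> carrier_mat g g"
    using B C by auto
  have MBC: "M - t \<cdot>\<^sub>m (B * C) \<in> carrier_mat n n"
    using smult_carrier_mat[OF BC] by (rule minus_carrier_mat)
  have N: "?N \<in> carrier_mat (n + g) (n + g)" and E: "?E \<in> carrier_mat (n + g) (n + g)"
    and F: "?F \<in> carrier_mat (n + g) (n + g)"
    using M B C by auto
  have "?N * ?E = four_block_mat (M * 1\<^sub>m n + (t \<cdot>\<^sub>m B) * (- C)) (M * 0\<^sub>m n g + (t \<cdot>\<^sub>m B) * 1\<^sub>m g)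
      (C * 1\<^sub>m n + 1\<^sub>m g * (- C)) (C * 0\<^sub>m n g + 1\<^sub>m g * 1\<^sub>m g)"
    by (rule mult_four_block_mat[OF M tB(1) C one_carrier_mat one_carrier_mat zero_carrier_mat
          mC one_carrier_mat])
  also have "M * 1\<^sub>m n + (t \<cdot>\<^sub>m B) * (- C) = M - t \<cdot>\<^sub>m (B * C)"
  proof -
    have "(t \<cdot>\<^sub>m B) * (- C) = - (t \<cdot>\<^sub>m (B * C))"
      using B C by (simp add: mult_smult_assoc_mat[OF B C])
    then show ?thesis using M BC by auto
  qed
  also have "M * 0\<^sub>m n g + (t \<cdot>\<^sub>m B) * 1\<^sub>m g = t \<cdot>\<^sub>m B"
    using M tB by (simp add: right_mult_one_mat[OF tB(1)])
  also have "C * 1\<^sub>m n + 1\<^sub>m g * (- C) = 0\<^sub>m g n" using C mC by auto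
  also have "C * 0\<^sub>m n g + 1\<^sub>m g * 1\<^sub>m g = 1\<^sub>m g" using C by simp
  finally have "det (?N * ?E) = det (M - t \<cdot>\<^sub>m (B * C)) * det (1\<^sub>m g :: 'a mat)"
    using det_four_block_mat_lower_left_zero[OF MBC tB(1) refl one_carrier_mat] by simp
  moreover have "det ?E = 1"
    using det_four_block_mat_upper_right_zero[OF one_carrier_mat refl mC one_carrier_mat] by simp
  ultimately have 1: "det ?N = det (M - t \<cdot>\<^sub>m (B * C))"
    using det_mult[OF N E] by simp
  have "?N * ?F = four_block_mat (M * 1\<^sub>m n + (t \<cdot>\<^sub>m B) * 0\<^sub>m g n)
      (M * ((- t) \<cdot>\<^sub>m B) + (t \<cdot>\<^sub>m B) * (a \<cdot>\<^sub>m 1\<^sub>m g))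
      (C * 1\<^sub>m n + 1\<^sub>m g * 0\<^sub>m g n) (C * ((- t) \<cdot>\<^sub>m B) + 1\<^sub>m g * (a \<cdot>\<^sub>m 1\<^sub>m g))"
    by (rule mult_four_block_mat[OF M tB(1) C one_carrier_mat one_carrier_mat tB(2)
          zero_carrier_mat a1(1)])
  also have "M * 1\<^sub>m n + (t \<cdot>\<^sub>m B) * 0\<^sub>m g n = M"
    using M by (simp add: right_mult_zero_mat[OF tB(1)])
  also have "M * ((- t) \<cdot>\<^sub>m B) + (t \<cdot>\<^sub>m B) * (a \<cdot>\<^sub>m 1\<^sub>m g) = 0\<^sub>m n g"
  proof -
    have "M * ((- t) \<cdot>\<^sub>m B) = (- t) \<cdot>\<^sub>m (a \<cdot>\<^sub>m B)" using mult_smult_distrib[OF M B] MB by simp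
    moreover have "(t \<cdot>\<^sub>m B) * (a \<cdot>\<^sub>m 1\<^sub>m g) = a \<cdot>\<^sub>m (t \<cdot>\<^sub>m B)"
      using mult_smult_distrib[OF tB(1) one_carrier_mat] right_mult_one_mat[OF tB(1)] by simp
    ultimately show ?thesis using B by auto
  qed
  also have "C * 1\<^sub>m n + 1\<^sub>m g * 0\<^sub>m g n = C" using C by simp
  also have "C * ((- t) \<cdot>\<^sub>m B) + 1\<^sub>m g * (a \<cdot>\<^sub>m 1\<^sub>m g) = (a - t) \<cdot>\<^sub>m 1\<^sub>m g"
    using mult_smult_distrib[OF C B] CB a1 by auto
  finally have "det (?N * ?F) = det M * det ((a - t) \<cdot>\<^sub>m 1\<^sub>m g)"
    using det_four_block_mat_upper_right_zero[OF M refl C a1(2)] by simp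
  moreover have "det ?F = a ^ g"
    using det_four_block_mat_lower_left_zero[OF one_carrier_mat tB(2) refl a1(1)] by simp
  ultimately show ?thesis
    using det_mult[OF N F] 1 by simp
qed

text \<open>Since \<open>C * B = 1\<close>, the columns of \<open>B\<close> are independent, and
  adding \<open>t B C\<close> moves \<open>g\<close> copies of the eigenvalue \<open>k\<close> to
  \<open>k + t\<close>. The determinant identity for \<open>x I - A\<close> with
  \<open>a = x - k\<close> gives this at every point \<open>x\<close>; in characteristic zero equal
  values force equal polynomials.\<close>

lemma char_poly_eigenspace_update:
  fixes A :: "'a :: field_char_0 mat"
  assumes A: "A \<in> carrier_mat n n" and B: "B \<in> carrier_mat n g" and C: "C \<in> carrier_mat g n"
    and AB: "A * B = k \<cdot>\<^sub>m B" and CB: "C * B = 1\<^sub>m g"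
  shows "char_poly (A + t \<cdot>\<^sub>m (B * C)) * [:- k, 1:] ^ g = char_poly A * [:- (k + t), 1:] ^ g"
proof -
  have "poly (char_poly (A + t \<cdot>\<^sub>m (B * C))) x * (x - k) ^ g = poly (char_poly A) x * (x - k - t) ^ g" for x
  proof -
    let ?M = "- char_matrix A x"
    have M: "?M \<in> carrier_mat n n" and BC: "B * C \<in> carrier_mat n n" using A B C by auto
    have "?M = x \<cdot>\<^sub>m 1\<^sub>m n - A" using A by (auto simp: char_matrix_def)
    then have "?M * B = x \<cdot>\<^sub>m B - A * B"
      using A B by (simp add: minus_mult_distrib_mat[OF _ A B] mult_smult_assoc_mat[OF one_carrier_mat B])
    then have MB: "?M * B = (x - k) \<cdot>\<^sub>m B" using AB B by (auto simp: algebra_simps)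
    have "- char_matrix (A + X) x = ?M - X" if "X \<in> carrier_mat n n" for X
      using A that by (auto simp: char_matrix_def)
    then have "- char_matrix (A + t \<cdot>\<^sub>m (B * C)) x = ?M - t \<cdot>\<^sub>m (B * C)"
      using BC by simp
    then show ?thesis
      using det_eigenspace_update[OF M B C MB CB, of t] A BC
      by (simp add: char_poly_matrix[of _ n])
  qed
  then have "poly (char_poly (A + t \<cdot>\<^sub>m (B * C)) * [:- k, 1:] ^ g) = poly (char_poly A * [:- (k + t), 1:] ^ g)"
    by (intro ext) (simp add: algebra_simps)
  then show ?thesis by (simp only: poly_eq_poly_eq_iff)
qed

lemma char_poly_nonzero: "A \<in> carrier_mat n n \<Longrightarrow> char_poly (A :: 'a :: field mat) \<noteq> 0"
  by (auto dest: degree_monic_char_poly)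

text \<open>Compare orders at \<open>k\<close> in the identity of characteristic polynomials: the
  left factor contributes \<open>g\<close>, while the right factor vanishes only at
  \<open>k + t\<close>, which differs from \<open>k\<close>.\<close>

lemma alg_mult_eigenspace_update:
  fixes A :: "'a :: field_char_0 mat"
  assumes A: "A \<in> carrier_mat n n" and B: "B \<in> carrier_mat n g" and C: "C \<in> carrier_mat g n"
    and AB: "A * B = k \<cdot>\<^sub>m B" and CB: "C * B = 1\<^sub>m g" and t: "t \<noteq> 0"
  shows "alg_mult A k = alg_mult (A + t \<cdot>\<^sub>m (B * C)) k + g"
proof -
  let ?A = "A + t \<cdot>\<^sub>m (B * C)"
  have A': "?A \<in> carrier_mat n n" using A B C by auto
  have "Polynomial.order k (char_poly ?A * [:- k, 1:] ^ g)
      = Polynomial.order k (char_poly A * [:- (k + t), 1:] ^ g)"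
    using char_poly_eigenspace_update[OF A B C AB CB] by simp
  moreover have "Polynomial.order k ([:- k, 1:] ^ g) = g" by (rule order_power_n_n)
  moreover have "Polynomial.order k ([:- (k + t), 1:] ^ g) = 0"
    using t by (intro order_0I) simp
  ultimately show ?thesis
    using char_poly_nonzero[OF A] char_poly_nonzero[OF A']
    by (simp add: alg_mult_def order_mult)
qed

lemma zero_mat_mult_vec: "v \<in> carrier_vec nc \<Longrightarrow> 0\<^sub>m nr nc *\<^sub>v v = 0\<^sub>v nr"
  by (intro eq_vecI) auto

lemma mult_mat_zero_vec: "A \<in> carrier_mat nr nc \<Longrightarrow> A *\<^sub>v 0\<^sub>v nc = 0\<^sub>v nr"
  by (intro eq_vecI) auto

text \<open>Shifting the eigenspace by \<open>B * C\<close> removes the eigenvalue \<open>k\<close> altogether.\<close>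

lemma alg_mult_eq_dim_eigenspace:
  fixes A :: "'a :: field_char_0 mat"
  assumes A: "A \<in> carrier_mat n n" and B: "B \<in> carrier_mat n g" and C: "C \<in> carrier_mat g n"
    and AB: "char_matrix A k * B = 0\<^sub>m n g" and CB: "C * B = 1\<^sub>m g"
    and ker: "\<And>v. v \<in> carrier_vec n \<Longrightarrow> char_matrix A k *\<^sub>v v = 0\<^sub>v n \<Longrightarrow> v = B *\<^sub>v (C *\<^sub>v v)"
    and index: "\<And>v. v \<in> carrier_vec n \<Longrightarrow> char_matrix A k *\<^sub>v (char_matrix A k *\<^sub>v v) = 0\<^sub>v n
      \<Longrightarrow> char_matrix A k *\<^sub>v v = 0\<^sub>v n"
  shows "alg_mult A k = g"
proof -
  let ?M = "char_matrix A k" and ?A = "A + 1 \<cdot>\<^sub>m (B * C)"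
  have M: "?M \<in> carrier_mat n n" and BC: "B * C \<in> carrier_mat n n" and A': "?A \<in> carrier_mat n n"
    using A B C by auto
  have "A = ?M + k \<cdot>\<^sub>m 1\<^sub>m n" using A by (auto simp: char_matrix_def)
  then have "A * B = ?M * B + (k \<cdot>\<^sub>m 1\<^sub>m n) * B"
    using add_mult_distrib_mat[OF M _ B] by (metis one_carrier_mat smult_carrier_mat)
  then have AB': "A * B = k \<cdot>\<^sub>m B"
    using AB B by (simp add: mult_smult_assoc_mat[OF one_carrier_mat B])
  have "\<not> eigenvalue ?A k"
  proof
    assume "eigenvalue ?A k"
    then obtain v where v: "v \<in> carrier_vec n" "v \<noteq> 0\<^sub>v n" "char_matrix ?A k *\<^sub>v v = 0\<^sub>v n"
      using eigenvalue_char_matrix[OF A'] by auto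
    have "char_matrix (A + X) k = ?M + X" if "X \<in> carrier_mat n n" for X
      using A that by (auto simp: char_matrix_def)
    then have "char_matrix ?A k = ?M + B * C" using BC by auto
    then have sum: "?M *\<^sub>v v + B *\<^sub>v (C *\<^sub>v v) = 0\<^sub>v n"
      using v add_mult_distrib_mat_vec[OF M BC] assoc_mult_mat_vec[OF B C] by simp
    have Cv: "C *\<^sub>v v \<in> carrier_vec g" using C v by auto
    have BCv: "B *\<^sub>v (C *\<^sub>v v) \<in> carrier_vec n" and Mv: "?M *\<^sub>v v \<in> carrier_vec n"
      using B M v Cv by auto
    \<comment> \<open>The columns of \<open>B\<close> lie in the kernel of \<open>?M\<close>, so
      applying \<open>?M\<close> to \<open>sum\<close> leaves \<open>?M (?M v) = 0\<close>. Then
      \<open>index\<close> gives \<open>?M v = 0\<close>, hence \<open>B (C v) = 0\<close>, which is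
      \<open>v\<close> by \<open>ker\<close>.\<close>
    have "?M *\<^sub>v (B *\<^sub>v (C *\<^sub>v v)) = 0\<^sub>v n"
      using assoc_mult_mat_vec[OF M B Cv, symmetric] AB Cv by (simp add: zero_mat_mult_vec)
    then have "?M *\<^sub>v (?M *\<^sub>v v) = 0\<^sub>v n"
      using arg_cong[OF sum, of "\<lambda>w. ?M *\<^sub>v w"] mult_add_distrib_mat_vec[OF M Mv BCv] M Mv
      by (simp add: mult_mat_zero_vec)
    then have Mv0: "?M *\<^sub>v v = 0\<^sub>v n" using index v by blast
    then have "B *\<^sub>v (C *\<^sub>v v) = 0\<^sub>v n" using sum BCv by simp
    then show False using ker[OF v(1) Mv0] v(2) by simp
  qed
  then have "alg_mult ?A k = 0"
    using eigenvalue_root_char_poly[OF A'] by (simp add: alg_mult_def order_0I)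
  then show ?thesis using alg_mult_eigenspace_update[OF A B C AB' CB, of 1] by simp
qed

section \<open>Kernel bases as matrices with left inverses\<close>

text \<open>Over the reals the Gram matrix of an injective \<open>B\<close> is invertible, because
  \<open>y\<close> paired with \<open>?G y\<close> is the squared norm of \<open>B y\<close>. The
  left inverse is the inverse Gram matrix times the transpose of \<open>B\<close>.\<close>

lemma mat_left_inverse_real:
  fixes B :: "real mat"
  assumes B: "B \<in> carrier_mat n g"
    and inj: "\<And>y. y \<in> carrier_vec g \<Longrightarrow> B *\<^sub>v y = 0\<^sub>v n \<Longrightarrow> y = 0\<^sub>v g"
  obtains C where "C \<in> carrier_mat g n" "C * B = 1\<^sub>m g"
proof -
  let ?G = "B\<^sup>T * B"
  have BT: "B\<^sup>T \<in> carrier_mat g n" and G: "?G \<in> carrier_mat g g" using B by auto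
  have self_orth: "w = 0\<^sub>v n" if "w \<in> carrier_vec n" "w \<bullet> w = 0" for w :: "real vec"
    using that by (auto simp: scalar_prod_def sum_nonneg_eq_0_iff)
  have "det ?G \<noteq> 0"
  proof
    assume "det ?G = 0"
    then obtain y where y: "y \<in> carrier_vec g" "y \<noteq> 0\<^sub>v g" "?G *\<^sub>v y = 0\<^sub>v g"
      using det_0_iff_vec_prod_zero_field[OF G] by auto
    have By: "B *\<^sub>v y \<in> carrier_vec n" using B y by auto
    have "(B *\<^sub>v y) \<bullet> (B *\<^sub>v y) = y \<bullet> (B\<^sup>T *\<^sub>v (B *\<^sub>v y))"
      using transpose_vec_mult_scalar[OF BT By y(1)] by simp
    also have "\<dots> = 0" using y assoc_mult_mat_vec[OF BT B y(1)] by simp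
    finally have "B *\<^sub>v y = 0\<^sub>v n" 
      using self_orth[OF By] by simp
    then show False using inj y by blast
  qed
  from det_non_zero_imp_unit[OF G this, unfolded Units_def, of "()"]
  obtain D where D: "D \<in> carrier_mat g g" "D * ?G = 1\<^sub>m g"
    unfolding ring_mat_def by auto
  have "(D * B\<^sup>T) * B = 1\<^sub>m g" using assoc_mult_mat[OF D(1) BT B] D by simp
  then show ?thesis using that[of "D * B\<^sup>T"] D BT by auto
qed

text \<open>Repackages an abstract basis of the kernel as the columns of a matrix, so that the
  update lemmas apply with \<open>g\<close> equal to the geometric multiplicity.\<close>

lemma kernel_basis_matrix:
  fixes A :: "'a :: field mat"
  assumes A: "A \<in> carrier_mat nr n"
  obtains B where "B \<in> carrier_mat n (kernel_dim A)" "A * B = 0\<^sub>m nr (kernel_dim A)"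
    "\<And>y. y \<in> carrier_vec (kernel_dim A) \<Longrightarrow> B *\<^sub>v y = 0\<^sub>v n \<Longrightarrow> y = 0\<^sub>v (kernel_dim A)"
    "\<And>v. v \<in> mat_kernel A \<Longrightarrow> \<exists>y \<in> carrier_vec (kernel_dim A). v = B *\<^sub>v y"
proof -
  interpret kernel nr n A by (unfold_locales) (rule A)
  obtain S where S: "finite S" "basis S" using kernel_basis_exists[OF A] by blast
  then have Sk: "S \<subseteq> mat_kernel A" by (simp add: Ker.basis_def)
  then have Sn: "S \<subseteq> carrier_vec n" using mat_kernel_carrier[OF A] by blast
  obtain ws where ws: "set ws = S" "distinct ws" using finite_distinct_list[OF S(1)] by blast
  let ?B = "mat_of_cols n ws"
  have g: "kernel_dim A = length ws"
    using Ker.dim_basis[OF S] ws distinct_card by fastforce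
  have nth: "ws ! i \<in> S" if "i < length ws" for i using ws that by auto
  have B: "?B \<in> carrier_mat n (length ws)" by simp
  have lc: "?B *\<^sub>v vec (length ws) (\<lambda>i. f (ws ! i)) = NC.lincomb f S" for f
    using NC.lincomb_as_lincomb_list_distinct[of ws f] NC.lincomb_list_as_mat_mult[of ws "\<lambda>i. f (ws ! i)"]
      ws Sn carrier_vecD by (metis subsetD)
  show thesis
  proof (rule that[of ?B])
    show "?B \<in> carrier_mat n (kernel_dim A)" using g by simp
    show "A * ?B = 0\<^sub>m nr (kernel_dim A)"
    proof (rule eq_matI)
      fix i j assume ij: "i < dim_row (0\<^sub>m nr (kernel_dim A) :: 'a mat)" "j < dim_col (0\<^sub>m nr (kernel_dim A) :: 'a mat)"
      then have j: "j < length ws" using g by simp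
      have "col ?B j = ws ! j" using j nth Sn by (intro col_mat_of_cols) auto
      moreover have "A *\<^sub>v (ws ! j) = 0\<^sub>v nr" using mat_kernelD[OF A] nth[OF j] Sk by blast
      ultimately show "(A * ?B) $$ (i, j) = 0\<^sub>m nr (kernel_dim A) $$ (i, j)"
        using ij A B j by (simp flip: index_mult_mat_vec)
    qed (use A g in auto)
  next
    fix y assume y: "y \<in> carrier_vec (kernel_dim A)" "?B *\<^sub>v y = 0\<^sub>v n"
    \<comment> \<open>Linear combinations take coefficients indexed by vectors, whereas
      \<open>y\<close> is indexed by positions; distinctness of \<open>ws\<close> makes the
      translation well defined.\<close>
    define f where "f w = y $ (THE i. i < length ws \<and> ws ! i = w)" for w
    have f: "f (ws ! i) = y $ i" if "i < length ws" for i
      unfolding f_def using ws(2) that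
      by (intro arg_cong[where f = "($) y"] the_equality) (auto simp: nth_eq_iff_index_eq)
    have "vec (length ws) (\<lambda>i. f (ws ! i)) = y" using y g f by auto
    then have "lincomb f S = 0\<^sub>v n" using lc[of f] y lincomb_same[OF Sk] by simp
    moreover have "\<not> lin_dep S" using S(2) by (simp add: Ker.basis_def)
    ultimately have "f w = 0" if "w \<in> S" for w
      using Ker.not_lindepD[of S S f] S(1) that by auto
    then show "y = 0\<^sub>v (kernel_dim A)" using f nth y g by (intro eq_vecI) auto
  next
    fix v assume "v \<in> mat_kernel A"
    then have "v \<in> span S" using S(2) by (simp add: Ker.basis_def)
    then obtain a where "v = lincomb a S" using Ker.finite_span[OF S(1) Sk] by auto
    then have "v = ?B *\<^sub>v vec (length ws) (\<lambda>i. a (ws ! i))" using lc lincomb_same[OF Sk] by simp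
    then show "\<exists>y \<in> carrier_vec (kernel_dim A). v = ?B *\<^sub>v y" using g by auto
  qed
qed

text \<open>A kernel basis \<open>B\<close> and a left inverse \<open>C\<close> satisfy
  \<open>B (C v) = v\<close> on the kernel, so the algebraic multiplicity equals the number of
  columns of \<open>B\<close>. The assumption \<open>index\<close> rules out generalized
  eigenvectors that are not eigenvectors.\<close>

lemma semisimple_if_index_one:
  fixes A :: "real mat"
  assumes A: "A \<in> carrier_mat n n"
    and index: "\<And>v. v \<in> carrier_vec n \<Longrightarrow> char_matrix A k *\<^sub>v (char_matrix A k *\<^sub>v v) = 0\<^sub>v n
      \<Longrightarrow> char_matrix A k *\<^sub>v v = 0\<^sub>v n"
  shows "semisimple A k"
proof -
  let ?M = "char_matrix A k"
  have M: "?M \<in> carrier_mat n n" using A by simp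
  obtain B where B: "B \<in> carrier_mat n (kernel_dim ?M)" "?M * B = 0\<^sub>m n (kernel_dim ?M)"
    and inj: "\<And>y. y \<in> carrier_vec (kernel_dim ?M) \<Longrightarrow> B *\<^sub>v y = 0\<^sub>v n \<Longrightarrow> y = 0\<^sub>v (kernel_dim ?M)"
    and ker: "\<And>v. v \<in> mat_kernel ?M \<Longrightarrow> \<exists>y \<in> carrier_vec (kernel_dim ?M). v = B *\<^sub>v y"
    using kernel_basis_matrix[OF M] by metis
  obtain C where C: "C \<in> carrier_mat (kernel_dim ?M) n" "C * B = 1\<^sub>m (kernel_dim ?M)"
    using mat_left_inverse_real[OF B(1) inj] by metis
  have "v = B *\<^sub>v (C *\<^sub>v v)" if v: "v \<in> carrier_vec n" "?M *\<^sub>v v = 0\<^sub>v n" for v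
  proof -
    obtain y where y: "y \<in> carrier_vec (kernel_dim ?M)" "v = B *\<^sub>v y"
      using ker mat_kernelI[OF M v] by blast
    then have "C *\<^sub>v v = y" using assoc_mult_mat_vec[OF C(1) B(1) y(1)] C(2) by simp
    then show ?thesis using y by simp
  qed
  then show ?thesis
    unfolding semisimple_def geom_mult_def
    using alg_mult_eq_dim_eigenspace[OF A B(1) C(1) B(2) C(2) _ index] by blast
qed

section \<open>In-forest dimension and reaching sets\<close>

definition reaching_set :: "('a, 'b) pre_digraph \<Rightarrow> 'a set \<Rightarrow> bool" where
  "reaching_set G R \<longleftrightarrow> R \<subseteq> verts G \<and> (\<forall>v \<in> verts G. \<exists>r \<in> R. v \<rightarrow>\<^sup>*\<^bsub>G\<^esub> r)"

section \<open>Weak components of a finite digraph\<close>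

text \<open>Among the connected subgraphs containing \<open>v\<close>, one with the largest total
  number of vertices and arcs is maximal; the one-vertex subgraph shows that there are
  candidates.\<close>

lemma (in fin_digraph) in_weak_component:
  assumes v: "v \<in> verts G"
  obtains H where "H \<in> weak_components G" "v \<in> verts H"
proof -
  define P where "P H \<longleftrightarrow> subgraph H G \<and> Digraph_Component.connected H \<and> v \<in> verts H" for H
  define size where "size H = card (verts H) + card (arcs H)" for H :: "('a, 'b) pre_digraph"
  have "P (G\<lparr>verts := {v}, arcs := {}\<rparr>)"
  proof -
    let ?H = "G\<lparr>verts := {v}, arcs := {}\<rparr>"
    have "wf_digraph ?H" by unfold_locales auto
    then have "subgraph ?H G" using v wf_digraph_axioms by (auto simp: subgraph_def compatible_def)
    moreover have "Digraph_Component.connected ?H"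
      by (auto simp: connected_def strongly_connected_def reachable_def)
    ultimately show ?thesis by (simp add: P_def)
  qed
  moreover have "size H < size G + 1" if "P H" for H
    using that by (auto simp: P_def size_def subgraph_def intro!: add_mono card_mono le_imp_less_Suc)
  ultimately obtain H where H: "P H" "\<And>H'. P H' \<Longrightarrow> size H' \<le> size H"
    using ex_has_greatest_nat[of P _ size "size G + 1"] by blast
  have "H' = H" if H': "subgraph H H'" "subgraph H' G" "Digraph_Component.connected H'" for H'
  proof -
    have fin: "finite (verts H')" "finite (arcs H')"
      using H'(2) finite_subset[OF _ finite_verts] finite_subset[OF _ finite_arcs] by (auto simp: subgraph_def)
    have sub: "verts H \<subseteq> verts H'" "arcs H \<subseteq> arcs H'" using H'(1) by (auto simp: subgraph_def)
    have "P H'" using H' H(1) sub by (auto simp: P_def)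
    then have "size H' \<le> size H" by (rule H(2))
    moreover have "card (verts H) \<le> card (verts H')" "card (arcs H) \<le> card (arcs H')"
      using fin sub by (auto intro: card_mono)
    ultimately have "card (verts H) = card (verts H')" "card (arcs H) = card (arcs H')"
      by (auto simp: size_def)
    then have "verts H = verts H'" "arcs H = arcs H'" using fin sub card_subset_eq by blast+
    then show ?thesis using H'(1) by (auto simp: subgraph_def compatible_def)
  qed
  then have "H \<in> weak_components G"
    using H(1) by (auto simp: weak_components_def max_subgraph_def P_def)
  then show thesis using that H(1) by (simp add: P_def)
qed

text \<open>A subgraph inherits the functions \<open>tail\<close> and \<open>head\<close>, so its
  vertex set and arc set determine it.\<close>

lemma (in fin_digraph) finite_weak_components: "finite (weak_components G)"
proof (rule finite_imageD)
  show "finite ((\<lambda>H. (verts H, arcs H)) ` weak_components G)"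
    by (rule finite_subset[of _ "Pow (verts G) \<times> Pow (arcs G)"])
      (auto simp: weak_components_def max_subgraph_def subgraph_def)
  show "inj_on (\<lambda>H. (verts H, arcs H)) (weak_components G)"
    by (auto simp: inj_on_def weak_components_def max_subgraph_def subgraph_def compatible_def)
qed

section \<open>Passing between converging forests and reaching sets\<close>

text \<open>One root is chosen per component; a path to the root inside a component is also a path
  in \<open>G\<close>.\<close>

lemma (in fin_digraph) forest_roots_reaching:
  assumes F: "spanning_converging_forest F G"
  obtains R where "reaching_set G R" "card R \<le> card (weak_components F)"
proof -
  have sub: "subgraph F G" "verts F = verts G" and comp: "\<And>T. T \<in> weak_components F \<Longrightarrow> converging_tree T"
    using F by (auto simp: spanning_converging_forest_def spanning_def)
  interpret F: fin_digraph F by (rule fin_digraph_subgraph[OF sub(1)])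
  have "\<exists>r \<in> verts T. \<forall>v \<in> verts T. v \<rightarrow>\<^sup>*\<^bsub>T\<^esub> r" if "T \<in> weak_components F" for T
    using comp[OF that] by (auto simp: converging_tree_def)
  then obtain r where r: "\<And>T. T \<in> weak_components F \<Longrightarrow> r T \<in> verts T"
    "\<And>T v. T \<in> weak_components F \<Longrightarrow> v \<in> verts T \<Longrightarrow> v \<rightarrow>\<^sup>*\<^bsub>T\<^esub> r T" by metis
  have subT: "subgraph T G" if "T \<in> weak_components F" for T
    using that subgraph_trans[OF _ sub(1)] by (auto simp: weak_components_def F.max_subgraph_def)
  have "reaching_set G (r ` weak_components F)"
    unfolding reaching_set_def
  proof (intro conjI ballI)
    show "r ` weak_components F \<subseteq> verts G" using r(1) subT by (auto simp: subgraph_def)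
    fix v assume "v \<in> verts G"
    then obtain T where "T \<in> weak_components F" "v \<in> verts T" using F.in_weak_component sub(2) by blast
    then show "\<exists>s \<in> r ` weak_components F. v \<rightarrow>\<^sup>* s" using r(2) subT reachable_mono by blast
  qed
  then show thesis using that card_image_le[OF F.finite_weak_components] by blast
qed

lemma (in fin_digraph) converging_forest_of_reaching_set:
  assumes R: "reaching_set G R"
  obtains F where "spanning_converging_forest F G" "card (weak_components F) \<le> card R"
proof -
  have RV: "R \<subseteq> verts G" and reach: "\<And>v. v \<in> verts G \<Longrightarrow> \<exists>r \<in> R. v \<rightarrow>\<^sup>* r"
    using R by (auto simp: reaching_set_def)
  define Q where "Q v k \<longleftrightarrow> (\<exists>p r. r \<in> R \<and> awalk v p r \<and> length p = k)" for v k
  \<comment> \<open>The distance from \<open>v\<close> to \<open>R\<close>. The first arc of a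
    shortest walk leads to a strictly closer vertex, and \<open>nx\<close> selects such an
    arc.\<close>
  define \<delta> where "\<delta> v = (LEAST k. Q v k)" for v
  have "\<exists>e \<in> arcs G. tail G e = v \<and> \<delta> (head G e) < \<delta> v" if v: "v \<in> verts G - R" for v
  proof -
    have "\<exists>k. Q v k" using reach v unfolding Q_def by (metis DiffD1 reachable_awalk)
    then have "Q v (\<delta> v)" unfolding \<delta>_def by (rule LeastI_ex)
    then obtain p r where p: "r \<in> R" "awalk v p r" "length p = \<delta> v" by (auto simp: Q_def)
    then obtain e q where e: "p = e # q" using v by (cases p) (auto simp: awalk_Nil_iff)
    then have "awalk (head G e) q r" "tail G e = v" "e \<in> arcs G" using p by (auto simp: awalk_Cons_iff)
    moreover have "\<delta> (head G e) \<le> length q"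
      unfolding \<delta>_def using calculation p by (intro Least_le) (auto simp: Q_def)
    ultimately show ?thesis using p e by auto
  qed
  then obtain nx where nx: "\<And>v. v \<in> verts G - R \<Longrightarrow> nx v \<in> arcs G"
    "\<And>v. v \<in> verts G - R \<Longrightarrow> tail G (nx v) = v"
    "\<And>v. v \<in> verts G - R \<Longrightarrow> \<delta> (head G (nx v)) < \<delta> v" by metis
  \<comment> \<open>Each vertex outside \<open>R\<close> keeps exactly the arc \<open>nx v\<close>,
    and vertices of \<open>R\<close> keep none, so walks in \<open>F\<close> are
    deterministic.\<close>
  define F where "F = G\<lparr>arcs := nx ` (verts G - R)\<rparr>"
  have F_simps [simp]: "verts F = verts G" "arcs F = nx ` (verts G - R)" "tail F = tail G" "head F = head G"
    by (simp_all add: F_def)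
  interpret F: wf_digraph F using nx(1) by unfold_locales auto
  have FG: "subgraph F G"
    using nx(1) F.wf_digraph_axioms wf_digraph_axioms by (auto simp: subgraph_def compatible_def)
  have adjF: "u \<rightarrow>\<^bsub>F\<^esub> w \<longleftrightarrow> u \<in> verts G - R \<and> w = head G (nx u)" for u w
    using nx(2) by (auto simp: arcs_ends_conv image_iff)
  have hv: "head G (nx v) \<in> verts G" if "v \<in> verts G - R" for v using nx(1)[OF that] by simp
  \<comment> \<open>Induction on the distance: outside \<open>R\<close> the first move is forced, so
    \<open>v\<close> and its successor reach the same members of \<open>R\<close>.\<close>
  have root_ex1: "\<exists>!r. r \<in> R \<and> v \<rightarrow>\<^sup>*\<^bsub>F\<^esub> r" if "v \<in> verts G" for v
    using that
  proof (induction "\<delta> v" arbitrary: v rule: less_induct)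
    case less
    show ?case
    proof (cases "v \<in> R")
      case True
      then have "r = v" if "v \<rightarrow>\<^sup>*\<^bsub>F\<^esub> r" for r
        using F.converse_reachable_cases[OF that] adjF by auto
      then show ?thesis using True less.prems by (intro ex1I[of _ v]) auto
    next
      case False
      let ?w = "head G (nx v)"
      have v: "v \<in> verts G - R" using False less.prems by blast
      have "v \<rightarrow>\<^sup>*\<^bsub>F\<^esub> r \<longleftrightarrow> ?w \<rightarrow>\<^sup>*\<^bsub>F\<^esub> r" if "r \<in> R" for r
      proof
        assume "v \<rightarrow>\<^sup>*\<^bsub>F\<^esub> r"
        then show "?w \<rightarrow>\<^sup>*\<^bsub>F\<^esub> r"
          using F.converse_reachable_cases[of v r] adjF False that by metis
      next
        assume "?w \<rightarrow>\<^sup>*\<^bsub>F\<^esub> r"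
        moreover have "v \<rightarrow>\<^bsub>F\<^esub> ?w" using adjF v by blast
        ultimately show "v \<rightarrow>\<^sup>*\<^bsub>F\<^esub> r" using F.adj_reachable_trans by blast
      qed
      then show ?thesis using less.hyps[OF nx(3)[OF v] hv[OF v]] by metis
    qed
  qed
  define rep where "rep v = (THE r. r \<in> R \<and> v \<rightarrow>\<^sup>*\<^bsub>F\<^esub> r)" for v
  have rep: "rep v \<in> R" "v \<rightarrow>\<^sup>*\<^bsub>F\<^esub> rep v" if "v \<in> verts G" for v
    using theI'[OF root_ex1[OF that]] by (simp_all add: rep_def)
  have rep_eq: "rep v = r" if "r \<in> R" "v \<rightarrow>\<^sup>*\<^bsub>F\<^esub> r" for v r
    using the1_equality[OF root_ex1] that F.reachable_in_verts(1)[OF that(2)] by (simp add: rep_def)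
  have rep_adj: "rep u = rep w" if "u \<rightarrow>\<^bsub>F\<^esub> w" for u w
  proof (rule rep_eq)
    have "w \<in> verts G" using F.adj_in_verts(2)[OF that] by simp
    then show "rep w \<in> R" "u \<rightarrow>\<^sup>*\<^bsub>F\<^esub> rep w" using rep F.adj_reachable_trans[OF that] by blast+
  qed
  have rep_root: "rep r = r" if "r \<in> R" for r using rep_eq[OF that] that RV by auto
  \<comment> \<open>The candidate component of \<open>r\<close>: everything that flows into
    \<open>r\<close> under \<open>F\<close>.\<close>
  define T where "T r = F \<restriction> {v \<in> verts G. rep v = r}" for r
  have TF: "subgraph (T r) F" for r
    unfolding T_def by (intro induced_imp_subgraph F.induced_induce) auto
  have reach_T: "v \<rightarrow>\<^sup>*\<^bsub>T r\<^esub> r" if "r \<in> R" "v \<in> verts (T r)" for r v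
    using that
  proof (induction "\<delta> v" arbitrary: v rule: less_induct)
    case less
    interpret T: wf_digraph "T r" using TF by (auto simp: subgraph_def)
    show ?case
    proof (cases "v \<in> R")
      case True
      then have "v = r" using less.prems rep_root by (simp add: T_def)
      then show ?thesis using less.prems by auto
    next
      case False
      let ?w = "head G (nx v)"
      have v: "v \<in> verts G - R" using False less.prems by (simp add: T_def)
      have "rep v = rep ?w" using rep_adj adjF v by blast
      then have w: "?w \<in> verts (T r)" using hv[OF v] less.prems by (simp add: T_def)
      moreover have "nx v \<in> arcs (T r)" "tail (T r) (nx v) = v" "head (T r) (nx v) = ?w"
        using v w less.prems nx(2) by (auto simp: T_def)
      then have "v \<rightarrow>\<^bsub>T r\<^esub> ?w" by (metis T.in_arcs_imp_in_arcs_ends)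
      ultimately show ?thesis
        using less.hyps[OF nx(3)[OF v]] less.prems(1) T.adj_reachable_trans by blast
    qed
  qed
  have conn_T: "Digraph_Component.connected (T r)" if "r \<in> R" for r
  proof -
    interpret T: wf_digraph "T r" using TF by (auto simp: subgraph_def)
    interpret S: pair_wf_digraph "mk_symmetric (T r)" by (rule T.wellformed_mk_symmetric)
    have to: "v \<rightarrow>\<^sup>*\<^bsub>mk_symmetric (T r)\<^esub> r" if "v \<in> verts (T r)" for v
      using reach_T[OF \<open>r \<in> R\<close> that] by (rule T.reachable_mk_symmetricI)
    have "u \<rightarrow>\<^sup>*\<^bsub>mk_symmetric (T r)\<^esub> v" if "u \<in> verts (T r)" "v \<in> verts (T r)" for u v
      using to[OF that(1)] symmetric_reachable[OF symmetric_mk_symmetric to[OF that(2)]]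
      by (rule S.reachable_trans)
    moreover have "r \<in> verts (T r)" using that RV rep_root by (auto simp: T_def)
    ultimately show ?thesis unfolding connected_def strongly_connected_def by auto
  qed
  \<comment> \<open>The distance strictly decreases along every nonempty walk of \<open>F\<close>,
    which excludes directed cycles.\<close>
  have decr: "(p \<noteq> [] \<longrightarrow> \<delta> v < \<delta> u) \<and> \<delta> v \<le> \<delta> u" if "F.awalk u p v" for u p v
    using that
  proof (induction p arbitrary: u)
    case Nil
    then show ?case by (simp add: F.awalk_Nil_iff)
  next
    case (Cons e p)
    then have p: "F.awalk (head G e) p v" and "e \<in> arcs F" "tail F e = u"
      by (simp_all add: F.awalk_Cons_iff)
    then have "\<delta> (head G e) < \<delta> u" using nx(2,3) by auto
    then show ?case using Cons.IH[OF p] by auto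
  qed
  have tree_T: "converging_tree (T r)" if r: "r \<in> R" for r
  proof -
    have wf: "wf_digraph (T r)" using TF by (auto simp: subgraph_def)
    have "\<not> F.cycle p" for p using decr by (fastforce simp: F.cycle_def)
    then have "tree (T r)"
      using conn_T[OF r] F.subgraph_cycle[OF TF] by (auto simp: tree_def forest_def)
    moreover have rT: "r \<in> verts (T r)" using r RV rep_root by (auto simp: T_def)
    moreover have "out_degree (T r) v = 1" if v: "v \<in> verts (T r) - {r}" for v
    proof -
      have vR: "v \<in> verts G - R" using v rep_root by (auto simp: T_def)
      have "rep v = rep (head G (nx v))" using rep_adj adjF vR by blast
      then have "rep (head G (nx v)) = r" using v by (simp add: T_def)
      then have "nx v \<in> out_arcs (T r) v"
        using v vR nx(2)[OF vR] hv[OF vR] by (simp add: out_arcs_def T_def)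
      moreover have "e = nx v" if "e \<in> out_arcs (T r) v" for e
        using that nx(2) by (auto simp: out_arcs_def T_def)
      ultimately have "out_arcs (T r) v = {nx v}" by blast
      then show ?thesis by (simp add: out_degree_def)
    qed
    ultimately show ?thesis using wf reach_T[OF r] by (auto simp: converging_tree_def)
  qed
  \<comment> \<open>\<open>rep\<close> is constant along arcs in either direction, so a connected
    \<open>H\<close> lies inside a single \<open>T r\<close>; maximality of \<open>H\<close> then
    gives equality.\<close>
  have comps: "weak_components F \<subseteq> T ` R"
  proof
    fix H assume "H \<in> weak_components F"
    then have HF: "subgraph H F" and conn: "Digraph_Component.connected H"
      and max: "\<And>H'. subgraph H H' \<Longrightarrow> subgraph H' F \<Longrightarrow> Digraph_Component.connected H' \<Longrightarrow> H' = H"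
      by (auto simp: weak_components_def F.max_subgraph_def)
    have HV: "verts H \<subseteq> verts G" using HF by (auto simp: subgraph_def)
    have rep_H: "rep u = rep v"
      if "(u, v) \<in> rtrancl_on (verts H) (parcs (mk_symmetric H))" for u v
      using that
    proof (induction rule: rtrancl_on_induct)
      case (step y z)
      then obtain e where e: "e \<in> arcs H" "(y, z) = (tail H e, head H e) \<or> (y, z) = (head H e, tail H e)"
        by (auto simp: parcs_mk_symmetric)
      then have "tail H e \<rightarrow>\<^bsub>F\<^esub> head H e"
        using F.adj_mono[OF _ HF] by (auto simp: arcs_ends_conv)
      then have "rep y = rep z" using rep_adj e(2) by auto
      then show ?case using step.IH by simp
    qed simp
    obtain v where v: "v \<in> verts H" using conn by (auto simp: connected_def strongly_connected_def)
    have "rep u = rep v" if "u \<in> verts H" for u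
      using conn that v by (intro rep_H) (auto simp: connected_def strongly_connected_def reachable_def)
    then have "subgraph H (T (rep v))"
      using HF TF[of "rep v"] HV wf_digraph.wellformed[of H]
      by (auto simp: subgraph_def compatible_def T_def)
    moreover have "rep v \<in> R" using rep(1) v HV by blast
    ultimately show "H \<in> T ` R" using max TF conn_T by blast
  qed
  have "spanning_converging_forest F G"
    using FG comps tree_T by (auto simp: spanning_converging_forest_def spanning_def)
  moreover have "finite R" by (rule finite_subset[OF RV finite_verts])
  then have "card (weak_components F) \<le> card R"
    by (meson comps card_image_le card_mono finite_imageI le_trans)
  ultimately show thesis by (rule that)
qed

text \<open>The two translations bound the minimal number of trees and the minimal size of a
  reaching set by each other. Starting from the full vertex set, they also show that some forest
  exists, so the \<open>LEAST\<close> is attained.\<close>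

lemma (in fin_digraph) in_forest_dimension_eq_card_reaching_set:
  obtains R where "reaching_set G R" "card R = in_forest_dimension G"
    "\<And>R'. reaching_set G R' \<Longrightarrow> card R \<le> card R'"
proof -
  let ?Q = "\<lambda>k. \<exists>F. spanning_converging_forest F G \<and> card (weak_components F) = k"
  have "reaching_set G (verts G)" by (auto simp: reaching_set_def)
  then have "\<exists>k. ?Q k" using converging_forest_of_reaching_set by blast
  then have "?Q (in_forest_dimension G)" unfolding in_forest_dimension_def by (rule LeastI_ex)
  then obtain R where R: "reaching_set G R" "card R \<le> in_forest_dimension G"
    using forest_roots_reaching by metis
  have le: "in_forest_dimension G \<le> card R'" if R': "reaching_set G R'" for R'
  proof -
    obtain F where F: "spanning_converging_forest F G" "card (weak_components F) \<le> card R'"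
      using converging_forest_of_reaching_set[OF R'] by blast
    have "in_forest_dimension G \<le> card (weak_components F)"
      unfolding in_forest_dimension_def using F(1) by (intro Least_le) blast
    then show ?thesis using F(2) by simp
  qed
  show thesis using that[of R] R le by (meson le_antisym le_trans)
qed

text \<open>If \<open>r\<close> reached another member \<open>r'\<close>, every vertex that relies
  on \<open>r\<close> could use \<open>r'\<close> instead, and \<open>R - {r}\<close> would be a
  smaller reaching set.\<close>

lemma (in fin_digraph) minimal_reaching_set_isolated:
  assumes R: "reaching_set G R" and min: "\<And>R'. reaching_set G R' \<Longrightarrow> card R \<le> card R'"
    and r: "r \<in> R" "r' \<in> R" "r \<rightarrow>\<^sup>* r'"
  shows "r' = r"
proof (rule ccontr)
  assume ne: "r' \<noteq> r"
  have fin: "finite R" using R finite_subset[OF _ finite_verts] by (simp add: reaching_set_def)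
  have "\<exists>s \<in> R - {r}. v \<rightarrow>\<^sup>* s" if v: "v \<in> verts G" for v
  proof -
    obtain s where s: "s \<in> R" "v \<rightarrow>\<^sup>* s" using R v by (auto simp: reaching_set_def)
    then have "v \<rightarrow>\<^sup>* r'" if "s = r" using that r(3) reachable_trans by blast
    then show ?thesis using s r(2) ne by blast
  qed
  then have "reaching_set G (R - {r})" using R by (auto simp: reaching_set_def)
  then show False using min card_Diff1_less[OF fin r(1)] by fastforce
qed

section \<open>The kernel of a standardized Laplacian\<close>

lemma finite_attains_max:
  fixes f :: "'a \<Rightarrow> 'b :: linorder"
  assumes "finite S" "S \<noteq> {}"
  shows "\<exists>i\<in>S. \<forall>j\<in>S. f j \<le> f i"
proof -
  have "Max (f ` S) \<in> f ` S" using assms by simp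
  then obtain i where "i \<in> S" "f i = Max (f ` S)" by force
  then show ?thesis using assms(1) by (metis Max_ge finite_imageI imageI)
qed

lemma standardized_laplacianD:
  assumes "standardized_laplacian n L"
  shows "L \<in> carrier_mat n n" "dim_row L = n" "dim_col L = n"
    and "\<And>i j. i < n \<Longrightarrow> j < n \<Longrightarrow> j \<noteq> i \<Longrightarrow> L $$ (i, j) \<le> 0"
    and "\<And>i j. i < n \<Longrightarrow> j < n \<Longrightarrow> j \<noteq> i \<Longrightarrow> - (1 / real n) \<le> L $$ (i, j)"
    and "\<And>i. i < n \<Longrightarrow> (\<Sum>j<n. L $$ (i, j)) = 0"
  using assms by (auto simp: standardized_laplacian_def)

text \<open>Vanishing row sums eliminate the diagonal. The weights \<open>- L $$ (i, j)\<close> are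
  nonnegative, so the sign of the sum can be read off where \<open>v\<close> is maximal.\<close>

lemma laplacian_mult_index:
  assumes L: "standardized_laplacian n L" and v: "v \<in> carrier_vec n" and i: "i < n"
  shows "(L *\<^sub>v v) $ i = (\<Sum>j\<in>{..<n} - {i}. - L $$ (i, j) * (v $ i - v $ j))"
proof -
  note D = standardized_laplacianD[OF L]
  have "(L *\<^sub>v v) $ i = (\<Sum>j<n. L $$ (i, j) * v $ j)"
    using D(1) v i by (auto simp: scalar_prod_def lessThan_atLeast0 intro!: sum.cong)
  also have "\<dots> = (\<Sum>j<n. L $$ (i, j) * v $ j) - (\<Sum>j<n. L $$ (i, j)) * v $ i"
    using D(6)[OF i] by simp
  also have "\<dots> = (\<Sum>j<n. - L $$ (i, j) * (v $ i - v $ j))"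
    unfolding sum_distrib_right sum_subtractf[symmetric]
    by (intro sum.cong) (simp_all add: algebra_simps)
  also have "\<dots> = (\<Sum>j\<in>{..<n} - {i}. - L $$ (i, j) * (v $ i - v $ j))"
    using i by (simp add: sum.remove[of _ i])
  finally show ?thesis .
qed

section \<open>Maximum principles\<close>

text \<open>At an index where \<open>x\<close> is maximal, every term of \<open>L x\<close> is
  nonnegative, so the maximum of \<open>x\<close> is at most the entry of \<open>x + t L x\<close>
  there.\<close>

lemma laplacian_resolvent_upper_bound:
  assumes L: "standardized_laplacian n L" and x: "x \<in> carrier_vec n" and t: "t \<ge> 0"
    and bound: "\<And>i. i < n \<Longrightarrow> x $ i + t * (L *\<^sub>v x) $ i \<le> M" and k: "k < n"
  shows "x $ k \<le> M"
proof -
  note D = standardized_laplacianD[OF L]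
  have "\<exists>i\<in>{..<n}. \<forall>j\<in>{..<n}. x $ j \<le> x $ i"
    using k by (intro finite_attains_max) auto
  then obtain i where i: "i < n" "\<And>j. j < n \<Longrightarrow> x $ j \<le> x $ i" by auto
  have "0 \<le> (L *\<^sub>v x) $ i"
    unfolding laplacian_mult_index[OF L x i(1)]
    using D(4)[OF i(1)] i(2) by (intro sum_nonneg mult_nonneg_nonneg) auto
  then have "x $ i \<le> M" using bound[OF i(1)] mult_nonneg_nonneg[OF t, of "(L *\<^sub>v x) $ i"] by linarith
  then show ?thesis using i(2)[OF k] by simp
qed

lemma laplacian_index_one:
  assumes L: "standardized_laplacian n L" and v: "v \<in> carrier_vec n"
    and LL: "L *\<^sub>v (L *\<^sub>v v) = 0\<^sub>v n"
  shows "L *\<^sub>v v = 0\<^sub>v n"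
proof -
  note D = standardized_laplacianD[OF L]
  \<comment> \<open>A one-sided bound; applied to both \<open>v\<close> and \<open>- v\<close> it
    forces \<open>L v = 0\<close>.\<close>
  have nonneg: "0 \<le> (L *\<^sub>v u) $ k"
    if u: "u \<in> carrier_vec n" and LLu: "L *\<^sub>v (L *\<^sub>v u) = 0\<^sub>v n" and k: "k < n" for u k
  proof (rule ccontr)
    assume neg: "\<not> 0 \<le> (L *\<^sub>v u) $ k"
    let ?w = "L *\<^sub>v u"
    define M where "M = Max ((\<lambda>i. u $ i) ` {..<n})"
    have M: "u $ i \<le> M" if "i < n" for i unfolding M_def using that by (intro Max_ge) auto
    \<comment> \<open>Chosen so that entry \<open>k\<close> of \<open>u - t ?w\<close> is exactly
      \<open>M + 1\<close>. As \<open>L ?w = 0\<close>, this vector \<open>?x\<close> satisfies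
      \<open>L ?x = ?w\<close> and \<open>?x + t L ?x = u\<close>, so its entries cannot exceed
      \<open>M\<close>.\<close>
    define t where "t = (M - u $ k + 1) / (- ?w $ k)"
    have t: "t \<ge> 0" unfolding t_def using neg M[OF k] by (intro divide_nonneg_nonneg) auto
    have w: "?w \<in> carrier_vec n" using D(1) u by auto
    let ?x = "u - t \<cdot>\<^sub>v ?w"
    have x: "?x \<in> carrier_vec n" using u w by auto
    have "L *\<^sub>v ?x = ?w - t \<cdot>\<^sub>v (L *\<^sub>v ?w)"
      using mult_minus_distrib_mat_vec[OF D(1) u, of "t \<cdot>\<^sub>v ?w"] mult_mat_vec[OF D(1) w] w by simp
    then have "L *\<^sub>v ?x = ?w" using LLu w D(2) by (intro eq_vecI) auto
    then have "?x $ k \<le> M"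
      using u w M D(2) by (intro laplacian_resolvent_upper_bound[OF L x t _ k]) auto
    then have "u $ k + (M - u $ k + 1) \<le> M"
      using u w k neg D(2) by (simp add: t_def)
    then show False by simp
  qed
  have mv: "- v \<in> carrier_vec n" and w: "L *\<^sub>v v \<in> carrier_vec n" using v D(1) by auto
  have Lmv: "L *\<^sub>v (- v) = - (L *\<^sub>v v)" and "L *\<^sub>v (- (L *\<^sub>v v)) = - (L *\<^sub>v (L *\<^sub>v v))"
    using D(2,3) v w by (auto intro!: eq_vecI)
  then have "L *\<^sub>v (L *\<^sub>v (- v)) = 0\<^sub>v n" using LL by simp
  then have "0 \<le> (- (L *\<^sub>v v)) $ k" if "k < n" for k using nonneg[OF mv _ that] Lmv by simp
  then show ?thesis
    using nonneg[OF v LL] w D(2) by (intro eq_vecI) (fastforce intro: antisym)+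
qed

lemma laplacian_digraph_simps:
  "verts (laplacian_digraph L) = {..<dim_row L}"
  "arcs_ends (laplacian_digraph L) =
    {(i, j). i < dim_row L \<and> j < dim_row L \<and> j \<noteq> i \<and> L $$ (i, j) < 0}"
  by (simp_all add: laplacian_digraph_def)

text \<open>Where a harmonic vertex attains the maximum over \<open>S\<close>, all its
  out-neighbours attain it too. The maximum therefore travels along a path towards \<open>R\<close>
  until it meets a vertex of \<open>R\<close>, where the bound \<open>c\<close> applies.\<close>

lemma laplacian_max_principle:
  assumes L: "standardized_laplacian n L" and v: "v \<in> carrier_vec n" and S: "S \<subseteq> {..<n}"
    and closed: "\<And>i j. i \<in> S \<Longrightarrow> i \<rightarrow>\<^bsub>laplacian_digraph L\<^esub> j \<Longrightarrow> j \<in> S"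
    and reach: "\<And>i. i \<in> S \<Longrightarrow> \<exists>r\<in>R. i \<rightarrow>\<^sup>*\<^bsub>laplacian_digraph L\<^esub> r"
    and harmonic: "\<And>i. i \<in> S - R \<Longrightarrow> (L *\<^sub>v v) $ i = 0"
    and bound: "\<And>r. r \<in> R \<inter> S \<Longrightarrow> v $ r \<le> c" and k: "k \<in> S"
  shows "v $ k \<le> c"
proof -
  note D = standardized_laplacianD[OF L]
  have "\<exists>i\<in>S. \<forall>j\<in>S. v $ j \<le> v $ i"
    using k S finite_subset[OF S] by (intro finite_attains_max) auto
  then obtain i where i: "i \<in> S" "\<And>j. j \<in> S \<Longrightarrow> v $ j \<le> v $ i" by auto
  obtain r where r: "r \<in> R" "i \<rightarrow>\<^sup>*\<^bsub>laplacian_digraph L\<^esub> r" using reach[OF i(1)] by blast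
  have "u \<in> S \<Longrightarrow> v $ u = v $ i \<Longrightarrow> v $ i \<le> c"
    if "(u, r) \<in> rtrancl_on (verts (laplacian_digraph L)) (arcs_ends (laplacian_digraph L))" for u
    using that
  proof (induction rule: converse_rtrancl_on_induct)
    case base
    then show ?case using bound[of r] r by simp
  next
    case (step u w)
    show ?case
    proof (cases "u \<in> R")
      case True
      then show ?thesis using bound[of u] step.prems by simp
    next
      case False
      have un: "u < n" and w: "w < n" "w \<noteq> u" "L $$ (u, w) < 0"
        using step.hyps D(2) by (auto simp: laplacian_digraph_simps)
      have wS: "w \<in> S" using closed step by blast
      have "(\<Sum>j\<in>{..<n} - {u}. - L $$ (u, j) * (v $ u - v $ j)) = 0"
        using harmonic[of u] False step.prems laplacian_mult_index[OF L v un] by simp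
      moreover have "0 \<le> - L $$ (u, j) * (v $ u - v $ j)" if j: "j \<in> {..<n} - {u}" for j
      proof (cases "L $$ (u, j) < 0")
        case True
        then have "j \<in> S"
          \<comment> \<open>Only arcs carry nonzero weight, and closedness keeps their heads in
            \<open>S\<close>, where \<open>v $ i\<close> is the maximum.\<close>
          using closed[of u j] step.prems j un D(2) by (auto simp: laplacian_digraph_simps)
        then show ?thesis using True i(2)[of j] step.prems by (intro mult_nonneg_nonneg) auto
      next
        case False
        then show ?thesis using D(4)[of u j] un j by simp
      qed
      ultimately have "- L $$ (u, w) * (v $ u - v $ w) = 0"
        using w by (subst (asm) sum_nonneg_eq_0_iff) fastforce+
      then have "v $ w = v $ i" using w step.prems by simp
      then show ?thesis using step.IH wS by blast
    qed
  qed
  then have "v $ i \<le> c" using r i(1) by (simp add: reachable_def)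
  then show ?thesis using i(2)[OF k] by simp
qed

text \<open>The maximum principle for \<open>v\<close> gives one inequality and for
  \<open>- v\<close> the other.\<close>

lemma laplacian_constancy_principle:
  assumes L: "standardized_laplacian n L" and v: "v \<in> carrier_vec n" and S: "S \<subseteq> {..<n}"
    and closed: "\<And>i j. i \<in> S \<Longrightarrow> i \<rightarrow>\<^bsub>laplacian_digraph L\<^esub> j \<Longrightarrow> j \<in> S"
    and reach: "\<And>i. i \<in> S \<Longrightarrow> \<exists>r\<in>R. i \<rightarrow>\<^sup>*\<^bsub>laplacian_digraph L\<^esub> r"
    and harmonic: "\<And>i. i \<in> S - R \<Longrightarrow> (L *\<^sub>v v) $ i = 0"
    and const: "\<And>r. r \<in> R \<inter> S \<Longrightarrow> v $ r = c" and k: "k \<in> S"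
  shows "v $ k = c"
proof (rule antisym)
  note D = standardized_laplacianD[OF L]
  have idx: "i < n" if "i \<in> S" for i using that S by auto
  show "v $ k \<le> c"
    using laplacian_max_principle[OF L v S closed reach harmonic _ k, where c = c] const by simp
  have mv: "- v \<in> carrier_vec n" using v by simp
  have "(L *\<^sub>v (- v)) $ i = 0" if "i \<in> S - R" for i
    using harmonic[OF that] idx[of i] that D(1,2) v by simp
  moreover have "(- v) $ r \<le> - c" if "r \<in> R \<inter> S" for r
    using const[OF that] idx[of r] that v by simp
  ultimately have "(- v) $ k \<le> - c"
    by - (rule laplacian_max_principle[OF L mv S closed reach _ _ k])
  then show "c \<le> v $ k" using idx[OF k] v by simp
qed

section \<open>The Dirichlet problem with values prescribed at the roots\<close>

text \<open>The roots form a list because their positions index the columns of a kernel basis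
  matrix.\<close>

locale laplacian_root_list =
  fixes n :: nat and L :: "real mat" and rs :: "nat list"
  assumes laplacian: "standardized_laplacian n L"
    and distinct_roots: "distinct rs" and roots: "set rs \<subseteq> {..<n}"
    and reaches_root: "\<And>i. i < n \<Longrightarrow> \<exists>r\<in>set rs. i \<rightarrow>\<^sup>*\<^bsub>laplacian_digraph L\<^esub> r"
    and isolated_root: "\<And>r r'. r \<in> set rs \<Longrightarrow> r' \<in> set rs \<Longrightarrow> r \<rightarrow>\<^sup>*\<^bsub>laplacian_digraph L\<^esub> r' \<Longrightarrow> r' = r"
begin

lemmas carrier = standardized_laplacianD(1)[OF laplacian]

text \<open>Uniqueness for the Dirichlet problem: the constancy principle on the whole vertex set
  with \<open>c = 0\<close>.\<close>

lemma harmonic_zero: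
  assumes "v \<in> carrier_vec n" "\<And>i. i < n \<Longrightarrow> i \<notin> set rs \<Longrightarrow> (L *\<^sub>v v) $ i = 0"
    and "\<And>r. r \<in> set rs \<Longrightarrow> v $ r = 0"
  shows "v = 0\<^sub>v n"
proof (rule eq_vecI)
  fix k assume k: "k < dim_vec (0\<^sub>v n :: real vec)"
  have "v $ k = 0"
  proof (rule laplacian_constancy_principle[OF laplacian assms(1), where S = "{..<n}" and R = "set rs"])
    show "j \<in> {..<n}" if "i \<rightarrow>\<^bsub>laplacian_digraph L\<^esub> j" for i j
      using that standardized_laplacianD(2)[OF laplacian] by (auto simp: laplacian_digraph_simps)
  qed (use k assms reaches_root in auto)
  then show "v $ k = 0\<^sub>v n $ k" using k by simp
qed (use assms in auto)

text \<open>The Dirichlet problem with boundary \<open>set rs\<close> is uniquely solvable; its solution is constant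
  on the set of vertices reachable from a root, hence harmonic at the roots as well.\<close>

lemma harmonic_extension:
  obtains h where "h \<in> carrier_vec n" "L *\<^sub>v h = 0\<^sub>v n" "\<And>r. r \<in> set rs \<Longrightarrow> h $ r = f r"
proof -
  interpret G: wf_digraph "laplacian_digraph L"
    by unfold_locales (auto simp: laplacian_digraph_def)
  note D = standardized_laplacianD[OF laplacian]
  \<comment> \<open>Unit rows replace the rows of \<open>L\<close> at the roots, so
    \<open>?N h = ?b\<close> says at once that \<open>h\<close> equals \<open>f\<close> on the roots
    and is harmonic elsewhere.\<close>
  let ?N = "mat n n (\<lambda>(i, j). if i \<in> set rs then (if i = j then 1 else 0) else L $$ (i, j))"
  let ?b = "vec n (\<lambda>i. if i \<in> set rs then f i else 0)"
  have N: "?N \<in> carrier_mat n n" by simp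
  have N_root: "(?N *\<^sub>v v) $ r = v $ r" if "v \<in> carrier_vec n" "r \<in> set rs" for v r
  proof -
    have "r < n" using that roots by auto
    moreover have "row ?N r = unit_vec n r" using that \<open>r < n\<close> by auto
    ultimately show ?thesis using that by simp
  qed
  have N_other: "(?N *\<^sub>v v) $ i = (L *\<^sub>v v) $ i" if "i < n" "i \<notin> set rs" for v i
  proof -
    have "row ?N i = row L i" using that D by auto
    then show ?thesis using that D by simp
  qed
  have "det ?N \<noteq> 0"
  proof
    assume "det ?N = 0"
    then obtain v where v: "v \<in> carrier_vec n" "v \<noteq> 0\<^sub>v n" "?N *\<^sub>v v = 0\<^sub>v n"
      using det_0_iff_vec_prod_zero_field[OF N] by blast
    have "v = 0\<^sub>v n"
    proof (rule harmonic_zero[OF v(1)])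
      show "(L *\<^sub>v v) $ i = 0" if "i < n" "i \<notin> set rs" for i using N_other[OF that, of v] v(3) that by simp
      show "v $ r = 0" if "r \<in> set rs" for r using N_root[OF v(1) that] v(3) that roots by auto
    qed
    then show False using v(2) by blast
  qed
  from det_non_zero_imp_unit[OF N this, unfolded Units_def, of "()"]
  obtain E where E: "E \<in> carrier_mat n n" "?N * E = 1\<^sub>m n" unfolding ring_mat_def by auto
  define h where "h = E *\<^sub>v ?b"
  have h: "h \<in> carrier_vec n" unfolding h_def using E by auto
  have Nh: "?N *\<^sub>v h = ?b" unfolding h_def using assoc_mult_mat_vec[OF N E(1), of ?b] E(2) by simp
  have h_root: "h $ r = f r" if "r \<in> set rs" for r using N_root[OF h that] Nh that roots by auto
  have Lh: "(L *\<^sub>v h) $ i = 0" if "i < n" "i \<notin> set rs" for i using N_other[OF that, of h] Nh that by simp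
  have Lh_root: "(L *\<^sub>v h) $ r = 0" if r: "r \<in> set rs" for r
  proof -
    \<comment> \<open>By isolation this set contains no root except \<open>r\<close>, so
      \<open>h\<close> is constant on it. Every arc leaving \<open>r\<close> stays inside, and all
      terms of \<open>L h\<close> at \<open>r\<close> vanish.\<close>
    let ?S = "{u. r \<rightarrow>\<^sup>*\<^bsub>laplacian_digraph L\<^esub> u}"
    have S: "?S \<subseteq> {..<n}"
    proof
      fix u assume "u \<in> ?S"
      then have "u \<in> verts (laplacian_digraph L)" using G.reachable_in_verts(2) by blast
      then show "u \<in> {..<n}" using D(2) by (simp add: laplacian_digraph_simps)
    qed
    have rn: "r < n" using r roots by auto
    have const: "h $ k = h $ r" if "k \<in> ?S" for k
    proof (rule laplacian_constancy_principle[OF laplacian h S, where R = "set rs"])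
      show "\<exists>r\<in>set rs. i \<rightarrow>\<^sup>*\<^bsub>laplacian_digraph L\<^esub> r" if "i \<in> ?S" for i
        using reaches_root that S by blast
      show "(L *\<^sub>v h) $ i = 0" if "i \<in> ?S - set rs" for i using Lh that S by auto
      show "h $ r' = h $ r" if "r' \<in> set rs \<inter> ?S" for r' using isolated_root[of r r'] r that by blast
      show "k \<in> ?S" by fact
    qed (blast intro: G.reachable_adj_trans)
    have "- L $$ (r, j) * (h $ r - h $ j) = 0" if j: "j \<in> {..<n} - {r}" for j
    proof (cases "L $$ (r, j) < 0")
      case True
      then have "r \<rightarrow>\<^bsub>laplacian_digraph L\<^esub> j" using j rn D(2) by (auto simp: laplacian_digraph_simps)
      then show ?thesis using const[of j] by auto
    next
      case False
      then show ?thesis using D(4)[OF rn, of j] j by auto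
    qed
    then show ?thesis unfolding laplacian_mult_index[OF laplacian h rn] by (intro sum.neutral ballI)
  qed
  have "L *\<^sub>v h = 0\<^sub>v n"
  proof (rule eq_vecI)
    show "(L *\<^sub>v h) $ i = 0\<^sub>v n $ i" if "i < dim_vec (0\<^sub>v n :: real vec)" for i
      using that Lh[of i] Lh_root[of i] by (cases "i \<in> set rs") (simp_all del: index_mult_mat_vec)
  qed (use D in simp)
  then show thesis using that h h_root by blast
qed

text \<open>The columns of \<open>B\<close> are the harmonic extensions of the indicators of single
  roots, and \<open>C\<close> restricts a vector to the roots. Thus \<open>C B = 1\<close>, and
  \<open>B C\<close> fixes the kernel because its vectors are determined by their root
  values.\<close>

lemma alg_mult_zero: "alg_mult L 0 = length rs"
proof -
  note D = standardized_laplacianD[OF laplacian]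
  let ?g = "length rs"
  have cm: "char_matrix L 0 = L" using D by (auto simp: char_matrix_def)
  have "\<exists>h. h \<in> carrier_vec n \<and> L *\<^sub>v h = 0\<^sub>v n \<and> (\<forall>r\<in>set rs. h $ r = (if r = s then 1 else 0))" for s
    using harmonic_extension[of "\<lambda>r. if r = s then 1 else 0"] by metis
  then obtain h where h: "\<And>s. h s \<in> carrier_vec n" "\<And>s. L *\<^sub>v h s = 0\<^sub>v n"
    "\<And>r s. r \<in> set rs \<Longrightarrow> h s $ r = (if r = s then 1 else 0)"
    by metis
  define B where "B = mat n ?g (\<lambda>(i, l). h (rs ! l) $ i)"
  define C where "C = mat ?g n (\<lambda>(l, j). if j = rs ! l then 1 else 0 :: real)"
  have B: "B \<in> carrier_mat n ?g" and C: "C \<in> carrier_mat ?g n" by (simp_all add: B_def C_def)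
  have colB: "col B l = h (rs ! l)" if "l < ?g" for l using that carrier_vecD[OF h(1)] by (intro eq_vecI) (auto simp: B_def)
  have rn: "rs ! l < n" if "l < ?g" for l using that roots nth_mem by blast
  have Cv: "(C *\<^sub>v v) $ l = v $ (rs ! l)" if "v \<in> carrier_vec n" "l < ?g" for v l
  proof -
    have "row C l = unit_vec n (rs ! l)" using that by (auto simp: C_def unit_vec_def)
    then show ?thesis using that rn C by simp
  qed
  have LB: "L * B = 0\<^sub>m n ?g"
  proof (rule eq_matI)
    fix i j assume "i < dim_row (0\<^sub>m n ?g :: real mat)" "j < dim_col (0\<^sub>m n ?g :: real mat)"
    then have ij: "i < n" "j < ?g" by auto
    then have "(L * B) $$ (i, j) = (L *\<^sub>v h (rs ! j)) $ i" using D B colB by simp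
    then show "(L * B) $$ (i, j) = 0\<^sub>m n ?g $$ (i, j)" using h(2) ij by simp
  qed (use D B in auto)
  have CB: "C * B = 1\<^sub>m ?g"
  proof (rule eq_matI)
    fix i j assume "i < dim_row (1\<^sub>m ?g :: real mat)" "j < dim_col (1\<^sub>m ?g :: real mat)"
    then have ij: "i < ?g" "j < ?g" by auto
    then have "(C * B) $$ (i, j) = (C *\<^sub>v h (rs ! j)) $ i" using C B colB by simp
    then show "(C * B) $$ (i, j) = 1\<^sub>m ?g $$ (i, j)"
      using Cv[OF h(1) ij(1)] h(3) ij distinct_roots by (simp add: nth_eq_iff_index_eq)
  qed (use B C in auto)
  have ker: "v = B *\<^sub>v (C *\<^sub>v v)" if v: "v \<in> carrier_vec n" "L *\<^sub>v v = 0\<^sub>v n" for v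
  proof -
    define y where "y = C *\<^sub>v v"
    have y: "y \<in> carrier_vec ?g" unfolding y_def using C v by auto
    define w where "w = B *\<^sub>v y"
    have w: "w \<in> carrier_vec n" unfolding w_def using B y by auto
    have "L *\<^sub>v w = 0\<^sub>v n"
      unfolding w_def using assoc_mult_mat_vec[OF carrier B y] LB zero_mat_mult_vec[OF y] by simp
    then have Ldiff: "L *\<^sub>v (v - w) = 0\<^sub>v n"
      using mult_minus_distrib_mat_vec[OF carrier v(1) w] v(2) by simp
    have Cw: "C *\<^sub>v w = y"
      unfolding w_def using assoc_mult_mat_vec[OF C B y] CB y by simp
    have diff: "v - w = 0\<^sub>v n"
    proof (rule harmonic_zero)
      show "v - w \<in> carrier_vec n" using v w by simp
      show "(L *\<^sub>v (v - w)) $ i = 0" if "i < n" for i using Ldiff that by simp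
      show "(v - w) $ r = 0" if r: "r \<in> set rs" for r
      proof -
        obtain l where l: "l < ?g" "r = rs ! l" using r by (metis in_set_conv_nth)
        have "v $ r = w $ r"
          using Cv[OF v(1) l(1), folded y_def] Cv[OF w l(1), unfolded Cw] l(2) by metis
        then show ?thesis using rn[OF l(1)] l(2) w by simp
      qed
    qed
    have "v = w"
    proof (rule eq_vecI)
      fix i assume "i < dim_vec w"
      then show "v $ i = w $ i" using arg_cong[OF diff, of "\<lambda>u. u $ i"] w by simp
    qed (use v w in simp)
    then show ?thesis by (simp add: w_def y_def)
  qed
  show ?thesis
    by (rule alg_mult_eq_dim_eigenspace[OF carrier B C, of 0, unfolded cm,
          OF LB CB ker laplacian_index_one[OF laplacian]])
qed

end

lemma fin_digraph_laplacian: "fin_digraph (laplacian_digraph L)"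
proof
  have "arcs (laplacian_digraph L) \<subseteq> {..<dim_row L} \<times> {..<dim_row L}"
    by (auto simp: laplacian_digraph_def)
  then show "finite (arcs (laplacian_digraph L))" by (rule finite_subset) simp
qed (auto simp: laplacian_digraph_def)

text \<open>A smallest reaching set, listed without repetition, supplies the roots; its minimality
  yields their isolation.\<close>

lemma alg_mult_zero_eq_in_forest_dimension:
  assumes L: "standardized_laplacian n L"
  shows "alg_mult L 0 = in_forest_dimension (laplacian_digraph L)"
proof -
  let ?G = "laplacian_digraph L"
  interpret fin_digraph ?G by (rule fin_digraph_laplacian)
  have V: "verts ?G = {..<n}" using standardized_laplacianD(2)[OF L] by (simp add: laplacian_digraph_simps)
  obtain R where R: "reaching_set ?G R" "card R = in_forest_dimension ?G"
    and min: "\<And>R'. reaching_set ?G R' \<Longrightarrow> card R \<le> card R'"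
    using in_forest_dimension_eq_card_reaching_set by metis
  have RV: "R \<subseteq> {..<n}" using R(1) V by (simp add: reaching_set_def)
  then obtain rs where rs: "set rs = R" "distinct rs"
    using finite_distinct_list finite_subset by (metis finite_lessThan)
  interpret laplacian_root_list n L rs
  proof
    show "\<exists>r\<in>set rs. i \<rightarrow>\<^sup>*\<^bsub>?G\<^esub> r" if "i < n" for i
      using R(1) V rs that by (auto simp: reaching_set_def)
    show "r' = r" if "r \<in> set rs" "r' \<in> set rs" "r \<rightarrow>\<^sup>*\<^bsub>?G\<^esub> r'" for r r'
      using minimal_reaching_set_isolated[OF R(1) min] that rs(1) by blast
  qed (use L rs RV in auto)
  show ?thesis using alg_mult_zero R(2) rs distinct_card by metis
qed

section \<open>Kernels under change of sign\<close>

lemma uminus_mult_mat_vec: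
  fixes A :: "'a :: comm_ring_1 mat"
  assumes "A \<in> carrier_mat nr nc" "v \<in> carrier_vec nc"
  shows "(- A) *\<^sub>v v = - (A *\<^sub>v v)"
  using assms by (intro eq_vecI) auto

lemma mult_mat_uminus_vec:
  fixes A :: "'a :: comm_ring_1 mat"
  assumes "A \<in> carrier_mat nr nc" "v \<in> carrier_vec nc"
  shows "A *\<^sub>v (- v) = - (A *\<^sub>v v)"
  using assms by (intro eq_vecI) auto

lemma uminus_vec_eq_zero: "- (v :: real vec) = 0\<^sub>v n \<longleftrightarrow> v = 0\<^sub>v n"
  by (metis uminus_uminus_vec uminus_zero_vec)

lemma kernel_dim_uminus:
  fixes A :: "real mat"
  assumes A: "A \<in> carrier_mat nr nc"
  shows "kernel_dim (- A) = kernel_dim A"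
proof -
  have "mat_kernel (- A) = mat_kernel A"
    using A uminus_mult_mat_vec[OF A] uminus_vec_eq_zero by (auto simp: mat_kernel_def)
  then show ?thesis by (simp add: kernel_dim_def)
qed

text \<open>\<open>Q\<close> and \<open>- Q\<close> have the same square. This transfers the
  index-one property to characteristic matrices at 1, which are negatives of matrices already
  treated.\<close>

lemma index_one_uminus:
  fixes Q :: "real mat"
  assumes Q: "Q \<in> carrier_mat n n" and v: "v \<in> carrier_vec n"
    and index: "Q *\<^sub>v (Q *\<^sub>v v) = 0\<^sub>v n \<Longrightarrow> Q *\<^sub>v v = 0\<^sub>v n"
    and "(- Q) *\<^sub>v ((- Q) *\<^sub>v v) = 0\<^sub>v n"
  shows "(- Q) *\<^sub>v v = 0\<^sub>v n"
proof -
  have Qv: "Q *\<^sub>v v \<in> carrier_vec n" using Q v by auto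
  have "(- Q) *\<^sub>v ((- Q) *\<^sub>v v) = Q *\<^sub>v (Q *\<^sub>v v)"
    using uminus_mult_mat_vec[OF Q v] uminus_mult_mat_vec[OF Q, of "- (Q *\<^sub>v v)"]
      mult_mat_uminus_vec[OF Q Qv] Qv by simp
  then show ?thesis using assms(4) index uminus_mult_mat_vec[OF Q v] uminus_vec_eq_zero by simp
qed

section \<open>Complementation\<close>

text \<open>Interpreted for both \<open>L\<close> and its complement, so each fact about
  \<open>L + J\<close> also serves \<open>Lc + J\<close>.\<close>

locale laplacian_average =
  fixes n :: nat and L J :: "real mat"
  assumes n: "n > 0" and laplacian: "standardized_laplacian n L"
    and J_def: "J = mat n n (\<lambda>_. 1 / real n)"
begin

lemmas L = standardized_laplacianD(1)[OF laplacian]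

lemma J: "J \<in> carrier_mat n n" by (simp add: J_def)

lemma LJ: "L * J = 0\<^sub>m n n"
proof (rule eq_matI)
  fix i j assume "i < dim_row (0\<^sub>m n n :: real mat)" "j < dim_col (0\<^sub>m n n :: real mat)"
  then have ij: "i < n" "j < n" by auto
  then have "(L * J) $$ (i, j) = (\<Sum>k<n. L $$ (i, k) * (1 / real n))"
    using L by (auto simp: J_def scalar_prod_def lessThan_atLeast0 intro!: sum.cong)
  also have "\<dots> = 0" using standardized_laplacianD(6)[OF laplacian ij(1)]
    by (simp flip: sum_divide_distrib)
  finally show "(L * J) $$ (i, j) = 0\<^sub>m n n $$ (i, j)" using ij by simp
qed (use L J in auto)

lemma JJ: "J * J = J"
  using n by (intro eq_matI) (auto simp: J_def scalar_prod_def)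

lemma LJ_vec: "x \<in> carrier_vec n \<Longrightarrow> L *\<^sub>v (J *\<^sub>v x) = 0\<^sub>v n"
  using assoc_mult_mat_vec[OF L J, of x] LJ zero_mat_mult_vec[of x n n] by simp

lemma JJ_vec: "x \<in> carrier_vec n \<Longrightarrow> J *\<^sub>v (J *\<^sub>v x) = J *\<^sub>v x"
  using assoc_mult_mat_vec[OF J J, of x] JJ by simp

lemma index_one:
  assumes x: "x \<in> carrier_vec n" and QQ: "(L + J) *\<^sub>v ((L + J) *\<^sub>v x) = 0\<^sub>v n"
  shows "(L + J) *\<^sub>v x = 0\<^sub>v n"
proof -
  note dist = add_mult_distrib_mat_vec[OF L J]
  have Lx: "L *\<^sub>v u \<in> carrier_vec n" and Jx: "J *\<^sub>v u \<in> carrier_vec n" if "u \<in> carrier_vec n" for u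
    using L J that by auto
  have L_sum: "L *\<^sub>v ((L + J) *\<^sub>v u) = L *\<^sub>v (L *\<^sub>v u)" if u: "u \<in> carrier_vec n" for u
    using mult_add_distrib_mat_vec[OF L Lx[OF u] Jx[OF u]] dist[OF u] LJ_vec[OF u] Lx[OF Lx[OF u]] by simp
  have ker: "L *\<^sub>v u = 0\<^sub>v n \<and> J *\<^sub>v u = 0\<^sub>v n" if u: "u \<in> carrier_vec n" "(L + J) *\<^sub>v u = 0\<^sub>v n" for u
  proof -
    have "L *\<^sub>v u = 0\<^sub>v n"
      using laplacian_index_one[OF laplacian u(1)] L_sum[OF u(1)] u(2) mult_mat_zero_vec[OF L] by simp
    then show ?thesis using dist[OF u(1)] u(2) Jx[OF u(1)] by simp
  qed
  have y: "(L + J) *\<^sub>v x \<in> carrier_vec n"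
    by (rule mult_mat_vec_carrier[OF add_carrier_mat[OF J] x])
  \<comment> \<open>Both \<open>L\<close> and \<open>J\<close> annihilate
    \<open>y = (L + J) x\<close>. From \<open>L y = L (L x)\<close> follows \<open>L x = 0\<close>,
    so \<open>y = J x\<close>, and then \<open>0 = J y = J x = y\<close> by idempotence of
    \<open>J\<close>.\<close>
  have "L *\<^sub>v x = 0\<^sub>v n"
    using ker[OF y QQ] L_sum[OF x] laplacian_index_one[OF laplacian x] by simp
  then have eq: "(L + J) *\<^sub>v x = J *\<^sub>v x" using dist[OF x] Jx[OF x] by simp
  then show ?thesis using ker[OF y QQ] JJ_vec[OF x] by simp
qed

text \<open>\<open>J\<close> is the product of the all-ones column, which \<open>L\<close>
  annihilates, and the row with entries \<open>1 / n\<close>. Adding it is a rank-one update with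
  \<open>k = 0\<close> and \<open>t = 1\<close>.\<close>

lemma alg_mult_add_average: "alg_mult L 0 = alg_mult (L + J) 0 + 1"
proof -
  let ?B = "mat n 1 (\<lambda>_. 1 :: real)" and ?C = "mat 1 n (\<lambda>_. 1 / real n)"
  have "L * ?B = 0 \<cdot>\<^sub>m ?B"
  proof (rule eq_matI)
    fix i j assume "i < dim_row (0 \<cdot>\<^sub>m ?B)" "j < dim_col (0 \<cdot>\<^sub>m ?B)"
    then have ij: "i < n" "j < 1" by auto
    then have "(L * ?B) $$ (i, j) = (\<Sum>k<n. L $$ (i, k))"
      using L by (auto simp: scalar_prod_def lessThan_atLeast0 intro!: sum.cong)
    then show "(L * ?B) $$ (i, j) = (0 \<cdot>\<^sub>m ?B) $$ (i, j)"
      using standardized_laplacianD(6)[OF laplacian ij(1)] ij by simp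
  qed (use L in auto)
  moreover have "?C * ?B = 1\<^sub>m 1" using n by (intro eq_matI) (auto simp: scalar_prod_def)
  moreover have "1 \<cdot>\<^sub>m (?B * ?C) = J" by (intro eq_matI) (auto simp: J_def scalar_prod_def)
  ultimately show ?thesis using alg_mult_eigenspace_update[OF L, of ?B 1 ?C 0 1] by simp
qed

end

text \<open>The map sending \<open>x\<close> to \<open>- 1 / n - x\<close> preserves the interval of
  admissible off-diagonal entries, and the row sums are \<open>1 - 1 - 0\<close>.\<close>

lemma standardized_laplacian_complement:
  assumes "n > 0" "standardized_laplacian n L"
  shows "standardized_laplacian n (1\<^sub>m n - mat n n (\<lambda>_. 1 / real n) - L)"
  using assms standardized_laplacianD[OF assms(2)]
  by (auto simp: standardized_laplacian_def sum_subtractf)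

lemma complementary_digraph_eq_laplacian_digraph:
  assumes "L \<in> carrier_mat n n"
  shows "complementary_digraph L = laplacian_digraph (1\<^sub>m n - mat n n (\<lambda>_. 1 / real n) - L)"
proof -
  have "{(i, j). i < n \<and> j < n \<and> j \<noteq> i \<and> L $$ (i, j) > - (1 / real n)} =
    {(i, j). i < n \<and> j < n \<and> j \<noteq> i \<and> (1\<^sub>m n - mat n n (\<lambda>_. 1 / real n) - L) $$ (i, j) < 0}"
    using assms by auto
  then show ?thesis using assms by (simp add: complementary_digraph_def laplacian_digraph_def)
qed

section \<open>Multiplicities and eigenvectors of \<open>L\<close>, \<open>P\<close> and
  \<open>Lc\<close>\<close>

theorem theorem4:
  fixes n d dc :: nat and L J K P Lc :: "real mat"
  assumes "n > 0"
    and "standardized_laplacian n L"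
    and "J = mat n n (\<lambda>_. 1 / real n)"
    and "K = 1\<^sub>m n - J"
    and "P = L + J"
    and "Lc = K - L"
    and "d = in_forest_dimension (laplacian_digraph L)"
    and "dc = in_forest_dimension (complementary_digraph L)"
  shows
    "(alg_mult L 0 = d \<and> int (alg_mult L 1) = int dc - 1) \<and>
     (int (alg_mult P 0) = int d - 1 \<and> alg_mult P 1 = dc) \<and>
     (int (alg_mult Lc 1) = int d - 1 \<and> alg_mult Lc 0 = dc) \<and>
     (eigenvalue L 0 \<longrightarrow> semisimple L 0) \<and> (eigenvalue L 1 \<longrightarrow> semisimple L 1) \<and>
     (eigenvalue P 0 \<longrightarrow> semisimple P 0) \<and> (eigenvalue P 1 \<longrightarrow> semisimple P 1) \<and>
     (eigenvalue Lc 1 \<longrightarrow> semisimple Lc 1) \<and> (eigenvalue Lc 0 \<longrightarrow> semisimple Lc 0) \<and>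
     eigenvectors P 0 = eigenvectors Lc 1 \<and>
     (\<forall>v \<in> eigenvectors L 0. K *\<^sub>v v \<noteq> 0\<^sub>v n \<longrightarrow> K *\<^sub>v v \<in> eigenvectors P 0) \<and>
     eigenvectors P 1 = eigenvectors Lc 0 \<and>
     (\<forall>x \<in> eigenvectors P 1. K *\<^sub>v x \<noteq> 0\<^sub>v n \<longrightarrow> K *\<^sub>v x \<in> eigenvectors L 1)"
proof -
  have L: "L \<in> carrier_mat n n" by (rule standardized_laplacianD(1)[OF assms(2)])
  have Lc_std: "standardized_laplacian n Lc"
    using standardized_laplacian_complement[OF assms(1,2)] assms(3,4,6) by simp
  interpret G: laplacian_average n L J by unfold_locales fact+
  interpret Gc: laplacian_average n Lc J by unfold_locales fact+
  note J = G.J and Lc = Gc.L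
  have K: "K \<in> carrier_mat n n" and P: "P \<in> carrier_mat n n" and Q: "Lc + J \<in> carrier_mat n n"
    using J L Lc assms(4,5) by auto
  \<comment> \<open>The identities \<open>Lc + J = I - L\<close> and \<open>Lc = I - P\<close> turn
    the eigenvalue 1 of one matrix into the eigenvalue 0 of another.\<close>
  have cm: "char_matrix L 0 = L" "char_matrix L 1 = - (Lc + J)" "char_matrix P 0 = P"
    "char_matrix P 1 = - Lc" "char_matrix Lc 1 = - P" "char_matrix Lc 0 = Lc"
    "char_matrix (Lc + J) 0 = Lc + J"
    using L J Lc assms(4,5,6) by (auto simp: char_matrix_def)
  note index = laplacian_index_one[OF assms(2)] laplacian_index_one[OF Lc_std]
    G.index_one[folded assms(5)] Gc.index_one
  have L0: "semisimple L 0" by (rule semisimple_if_index_one[OF L]) (auto simp: cm intro: index)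
  have L1: "semisimple L 1"
    by (rule semisimple_if_index_one[OF L], unfold cm, rule index_one_uminus[OF Q]) (auto intro: index)
  have P0: "semisimple P 0" by (rule semisimple_if_index_one[OF P]) (auto simp: cm intro: index)
  have P1: "semisimple P 1"
    by (rule semisimple_if_index_one[OF P], unfold cm, rule index_one_uminus[OF Lc]) (auto intro: index)
  have Lc1: "semisimple Lc 1"
    by (rule semisimple_if_index_one[OF Lc], unfold cm, rule index_one_uminus[OF P]) (auto intro: index)
  have Lc0: "semisimple Lc 0" by (rule semisimple_if_index_one[OF Lc]) (auto simp: cm intro: index)
  have Q0: "semisimple (Lc + J) 0" by (rule semisimple_if_index_one[OF Q]) (auto simp: cm intro: index)
  note geom = L0 L1 P0 P1 Lc1 Lc0 Q0
  have mL0: "alg_mult L 0 = d"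
    using alg_mult_zero_eq_in_forest_dimension[OF assms(2)] assms(7) by simp
  have mLc0: "alg_mult Lc 0 = dc"
    using alg_mult_zero_eq_in_forest_dimension[OF Lc_std] complementary_digraph_eq_laplacian_digraph[OF L]
      assms(3,4,6,8) by simp
  have mP0: "int (alg_mult P 0) = int d - 1" using G.alg_mult_add_average mL0 assms(5) by simp
  \<comment> \<open>Semisimplicity turns each multiplicity into a kernel dimension, which a change
    of sign preserves.\<close>
  have mLc1: "alg_mult Lc 1 = alg_mult P 0" and mP1: "alg_mult P 1 = alg_mult Lc 0"
    and "alg_mult L 1 = alg_mult (Lc + J) 0"
    using geom kernel_dim_uminus[OF P] kernel_dim_uminus[OF Lc] kernel_dim_uminus[OF Q]
    by (simp_all add: semisimple_def geom_mult_def cm)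
  then have mL1: "int (alg_mult L 1) = int dc - 1" using Gc.alg_mult_add_average mLc0 by simp
  have eig: "eigenvectors P 0 = eigenvectors Lc 1" "eigenvectors P 1 = eigenvectors Lc 0"
    using uminus_mult_mat_vec[OF P] uminus_mult_mat_vec[OF Lc] uminus_vec_eq_zero
    by (auto simp: eigenvectors_def eigenvector_char_matrix[OF P] eigenvector_char_matrix[OF Lc] cm)
  \<comment> \<open>\<open>K\<close> is the projection complementary to \<open>J\<close>: it does
    not affect a subsequent \<open>L\<close>, and \<open>J\<close> annihilates its range.\<close>
  have Kv: "K *\<^sub>v v = v - J *\<^sub>v v" and LK: "L *\<^sub>v (K *\<^sub>v v) = L *\<^sub>v v" and JK: "J *\<^sub>v (K *\<^sub>v v) = 0\<^sub>v n"
    and Kc: "K *\<^sub>v v \<in> carrier_vec n"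
    if v: "v \<in> carrier_vec n" for v
  proof -
    have Jv: "J *\<^sub>v v \<in> carrier_vec n" and Lv: "L *\<^sub>v v \<in> carrier_vec n" using J L v by auto
    show Kv: "K *\<^sub>v v = v - J *\<^sub>v v" using minus_mult_distrib_mat_vec[OF one_carrier_mat J v] v assms(4) by simp
    show "L *\<^sub>v (K *\<^sub>v v) = L *\<^sub>v v"
      using mult_minus_distrib_mat_vec[OF L v Jv] G.LJ_vec[OF v] Lv unfolding Kv by simp
    show "J *\<^sub>v (K *\<^sub>v v) = 0\<^sub>v n"
      using mult_minus_distrib_mat_vec[OF J v Jv] G.JJ_vec[OF v] Jv unfolding Kv by simp
    show "K *\<^sub>v v \<in> carrier_vec n" using K v by auto
  qed
  have iv1: "K *\<^sub>v v \<in> eigenvectors P 0" if "v \<in> eigenvectors L 0" "K *\<^sub>v v \<noteq> 0\<^sub>v n" for v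
  proof -
    have v: "v \<in> carrier_vec n" "L *\<^sub>v v = 0\<^sub>v n"
      using that(1) by (auto simp: eigenvectors_def eigenvector_char_matrix[OF L] cm)
    then have "P *\<^sub>v (K *\<^sub>v v) = 0\<^sub>v n"
      using add_mult_distrib_mat_vec[OF L J Kc[OF v(1)]] LK[OF v(1)] JK[OF v(1)] assms(5) by simp
    then show ?thesis
      using Kc[OF v(1)] that(2) by (simp add: eigenvectors_def eigenvector_char_matrix[OF P] cm)
  qed
  have iv2: "K *\<^sub>v x \<in> eigenvectors L 1" if "x \<in> eigenvectors P 1" "K *\<^sub>v x \<noteq> 0\<^sub>v n" for x
  proof -
    have x: "x \<in> carrier_vec n" "P *\<^sub>v x = x"
      using that(1) P by (auto simp: eigenvectors_def eigenvector_def)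
    have Jx: "J *\<^sub>v x \<in> carrier_vec n" and Lx: "L *\<^sub>v x \<in> carrier_vec n" using J L x by auto
    have cancel: "a = a + b - b" if "a \<in> carrier_vec n" "b \<in> carrier_vec n" for a b :: "real vec"
      using that by (intro eq_vecI) auto
    \<comment> \<open>From \<open>P x = x\<close> one gets \<open>L x = x - J x = K x\<close>, and
      \<open>L (K x) = L x\<close> closes the loop.\<close>
    have "L *\<^sub>v x + J *\<^sub>v x = x" using add_mult_distrib_mat_vec[OF L J x(1)] x(2) assms(5) by simp
    then have "L *\<^sub>v x = x - J *\<^sub>v x" using cancel[OF Lx Jx] by simp
    then have "L *\<^sub>v (K *\<^sub>v x) = K *\<^sub>v x" using LK[OF x(1)] Kv[OF x(1)] by simp
    then show ?thesis using Kc[OF x(1)] that(2) L by (simp add: eigenvectors_def eigenvector_def)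
  qed
  show ?thesis
    using mL0 mLc0 mP0 mLc1 mP1 mL1 geom eig iv1 iv2 by simp
qed

end
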